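(* Let $p\in\mathbb{R}$ with $p>1$, let $n\in\mathbb{N}$, and let $G$ be a group of type $FP_n$ whose center contains an element of infinite order. Then $\overline{H^{(p)}_i(G)}=\overline{H_{(p)}^i(G)}=0$ for all $i\le n$.
   Context: $\mathbb{Z}[G]$ is the integral group ring and $\mathbb{Z}$ is the trivial $\mathbb{Z}[G]$-module. A group $G$ is of type $FP_n$ if there is an exact sequence $F_n\to\dots\to F_0\to\mathbb{Z}\to 0$ of $\mathbb{Z}[G]$-modules with $F_0,\dots,F_n$ projective and finitely generated. For real $p\ge 1$, $l^p(G)$ is the Banach space of formal sums $f=\sum_{g\in G}f_g g$ with $f_g\in\mathbb{C}$, only countably many $f_g\ne 0$, and $\sum_{g}|f_g|^p=(|f|_p)^p<\infty$; it is a $\mathbb{Z}[G]$-module via translation by $G$. For a projective resolution $\cdots\to F_2\xrightarrow{\partial_2}F_1\xrightarrow{\partial_1}F_0\xrightarrow{\varepsilon}\mathbb{Z}\to 0$ over $\mathbb{Z}[G]$, consider the chain complex $F_i\otimes_{\mathbb{Z}[G]}l^p(G)$, $i\ge0$, with boundary maps $\partial_i\otimes 1$ (left modules being turned into right modules via $xg=g^{-1}x$ when forming tensor products), and the cochain complex $\operatorname{Hom}_{\mathbb{Z}[G]}(F_i,l^p(G))$, $i\ge 0$, with $\widetilde\partial_i(\varphi)=\varphi\circ\partial_i$ (maps with index $0$ are zero). The reduced $l^p$-homology and $l^p$-cohomology are $\overline{H^{(p)}_i(G)}=\ker(\partial_i\otimes1)/\overline{\operatorname{im}(\partial_{i+1}\otimes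 1)}$ and $\overline{H_{(p)}^i(G)}=\ker(\widetilde\partial_{i+1})/\overline{\operatorname{im}(\widetilde\partial_i)}$. For $G$ of type $FP_n$ the resolution is taken with $F_0,\dots,F_n$ finitely generated; then for $i\le n$ the spaces $F_i\otimes_{\mathbb{Z}[G]}l^p(G)$ and $\operatorname{Hom}_{\mathbb{Z}[G]}(F_i,l^p(G))$ carry natural Banach space topologies (both are $l^p(G)^{m_i}$ if $F_i$ is free of rank $m_i$), in which the closures are taken. *)

theory Defs
  imports "HOL-Analysis.Analysis" "HOL-Algebra.Module" "HOL-Algebra.Free_Abelian_Groups"
begin

section \<open>Left modules over a (possibly noncommutative) ring\<close>

text \<open>The library locale \<open>module\<close> requires a commutative ring; the axioms below are exactly the
  same ones over an arbitrary ring.  The record type is the library's; its ring-multiplication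
  fields \<open>mult\<close> and \<open>one\<close> play no role for modules and are left unspecified throughout.\<close>

locale left_module = R?: ring R + M?: abelian_group M 
  for R :: "('r, 'x) ring_scheme" (structure) and M :: "('r, 'a, 'y) module_scheme" (structure) +
  assumes smult_closed:
      "\<lbrakk>a \<in> carrier R; x \<in> carrier M\<rbrakk> \<Longrightarrow> a \<odot>\<^bsub>M\<^esub> x \<in> carrier M"
    and smult_l_distr:
      "\<lbrakk>a \<in> carrier R; b \<in> carrier R; x \<in> carrier M\<rbrakk> \<Longrightarrow>
        (a \<oplus>\<^bsub>R\<^esub> b) \<odot>\<^bsub>M\<^esub> x = a \<odot>\<^bsub>M\<^esub> x \<oplus>\<^bsub>M\<^esub> b \<odot>\<^bsub>M\<^esub> x"
    and smult_r_distr: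
      "\<lbrakk>a \<in> carrier R; x \<in> carrier M; y \<in> carrier M\<rbrakk> \<Longrightarrow>
        a \<odot>\<^bsub>M\<^esub> (x \<oplus>\<^bsub>M\<^esub> y) = a \<odot>\<^bsub>M\<^esub> x \<oplus>\<^bsub>M\<^esub> a \<odot>\<^bsub>M\<^esub> y"
    and smult_assoc1:
      "\<lbrakk>a \<in> carrier R; b \<in> carrier R; x \<in> carrier M\<rbrakk> \<Longrightarrow>
        (a \<otimes>\<^bsub>R\<^esub> b) \<odot>\<^bsub>M\<^esub> x = a \<odot>\<^bsub>M\<^esub> (b \<odot>\<^bsub>M\<^esub> x)"
    and smult_one:
      "x \<in> carrier M \<Longrightarrow> \<one>\<^bsub>R\<^esub> \<odot>\<^bsub>M\<^esub> x = x"

definition mod_hom ::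
  "('r, 'x) ring_scheme \<Rightarrow> ('r, 'a, 'y) module_scheme \<Rightarrow> ('r, 'b, 'z) module_scheme \<Rightarrow> ('a \<Rightarrow> 'b) set"
  where "mod_hom R M N = {f \<in> carrier M \<rightarrow> carrier N.
    (\<forall>x\<in>carrier M. \<forall>y\<in>carrier M. f (x \<oplus>\<^bsub>M\<^esub> y) = f x \<oplus>\<^bsub>N\<^esub> f y) \<and>
    (\<forall>a\<in>carrier R. \<forall>x\<in>carrier M. f (a \<odot>\<^bsub>M\<^esub> x) = a \<odot>\<^bsub>N\<^esub> f x)}"

definition mod_ker :: "('r, 'a, 'y) module_scheme \<Rightarrow> ('r, 'b, 'z) module_scheme \<Rightarrow> ('a \<Rightarrow> 'b) \<Rightarrow> 'a set"
  where "mod_ker M N f = {x \<in> carrier M. f x = \<zero>\<^bsub>N\<^esub>}"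

definition fin_gen_module :: "('r, 'x) ring_scheme \<Rightarrow> ('r, 'a, 'y) module_scheme \<Rightarrow> bool"
  where "fin_gen_module R M \<longleftrightarrow> (\<exists>(m::nat) x. x \<in> {..<m} \<rightarrow> carrier M \<and>
    (\<forall>y\<in>carrier M. \<exists>a \<in> {..<m} \<rightarrow> carrier R. y = (\<Oplus>\<^bsub>M\<^esub>j\<in>{..<m}. a j \<odot>\<^bsub>M\<^esub> x j)))"

text \<open>The free module \<open>R\<^sup>(\<^sup>S\<^sup>)\<close>: finitely supported families \<open>S \<rightarrow> R\<close>, extended by zero.\<close>

definition free_left_module :: "('r, 'x) ring_scheme \<Rightarrow> 'a set \<Rightarrow> ('r, 'a \<Rightarrow> 'r) module"
  where "free_left_module R S = \<lparr>
    carrier = {f. (\<forall>x. f x \<in> carrier R) \<and> finite {x. f x \<noteq> \<zero>\<^bsub>R\<^esub>} \<and> {x. f x \<noteq> \<zero>\<^bsub>R\<^esub>} \<subseteq> S},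
    monoid.mult = undefined, one = undefined,
    ring.zero = (\<lambda>x. \<zero>\<^bsub>R\<^esub>),
    ring.add = (\<lambda>f h x. f x \<oplus>\<^bsub>R\<^esub> h x),
    module.smult = (\<lambda>a f x. a \<otimes>\<^bsub>R\<^esub> f x)\<rparr>"

text \<open>A module is projective if it is a direct summand of (equivalently: a retract of) a free
  module.  A projective \<open>P\<close> is a retract of the free module on its own underlying set, so no larger
  index sets are needed.\<close>

definition projective_module :: "('r, 'x) ring_scheme \<Rightarrow> ('r, 'a, 'y) module_scheme \<Rightarrow> bool"
  where "projective_module R P \<longleftrightarrow> left_module R P \<and>
    (\<exists>s r. s \<in> mod_hom R P (free_left_module R (carrier P)) \<and>
           r \<in> mod_hom R (free_left_module R (carrier P)) P \<and>
           (\<forall>x\<in>carrier P. r (s x) = x))"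

section \<open>The integral group ring, type \<open>FP\<^sub>n\<close>, projective resolutions\<close>

text \<open>Elements of \<open>\<int>[G]\<close> are finitely supported functions; \<open>frag_of g\<close> is the basis element \<open>g\<close>, and
  \<open>frag_extend\<close> is the additive extension of a map given on basis elements.\<close>

definition group_ring :: "('g, 'x) monoid_scheme \<Rightarrow> ('g \<Rightarrow>\<^sub>0 int) ring"
  where "group_ring G = \<lparr>
    carrier = {a. Poly_Mapping.keys a \<subseteq> carrier G},
    monoid.mult = (\<lambda>a b. frag_extend (\<lambda>g. frag_extend (\<lambda>h. frag_of (g \<otimes>\<^bsub>G\<^esub> h)) b) a),
    one = frag_of \<one>\<^bsub>G\<^esub>, ring.zero = 0, ring.add = (+)\<rparr>"

text \<open>The linear extension of \<open>g \<mapsto> g\<^sup>-\<^sup>1\<close>.  A left module becomes a right module by \<open>x a = a\<^sup>* x\<close>,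
  which on group elements is \<open>x g = g\<^sup>-\<^sup>1 x\<close>.\<close>

definition group_ring_star :: "('g, 'x) monoid_scheme \<Rightarrow> ('g \<Rightarrow>\<^sub>0 int) \<Rightarrow> ('g \<Rightarrow>\<^sub>0 int)"
  where "group_ring_star G a = frag_extend (\<lambda>g. frag_of (inv\<^bsub>G\<^esub> g)) a"

text \<open>\<open>\<int>\<close> with trivial \<open>G\<close>-action: \<open>\<int>[G]\<close> acts through the augmentation.\<close>

definition trivial_module :: "('g \<Rightarrow>\<^sub>0 int, int) module"
  where "trivial_module = \<lparr>
    carrier = UNIV, monoid.mult = undefined, one = undefined, ring.zero = 0, ring.add = (+),
    module.smult = (\<lambda>a k. (\<Sum>g\<in>Poly_Mapping.keys a. Poly_Mapping.lookup a g) * k)\<rparr>"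

text \<open>Exactness of \<open>F\<^sub>n \<rightarrow> \<dots> \<rightarrow> F\<^sub>0 \<rightarrow> \<int> \<rightarrow> 0\<close> (no condition at \<open>F\<^sub>n\<close>); \<open>d i\<close> is the map
  \<open>F\<^sub>i \<rightarrow> F\<^sub>i\<^sub>-\<^sub>1\<close> for \<open>i \<ge> 1\<close>, and \<open>d 0\<close> is never used.\<close>

definition exact_augmented ::
  "('g, 'x) monoid_scheme \<Rightarrow> nat \<Rightarrow> (nat \<Rightarrow> ('g \<Rightarrow>\<^sub>0 int, 'a) module) \<Rightarrow> (nat \<Rightarrow> 'a \<Rightarrow> 'a) \<Rightarrow> ('a \<Rightarrow> int) \<Rightarrow> bool"
  where "exact_augmented G n F d \<epsilon> \<longleftrightarrow>
    \<epsilon> \<in> mod_hom (group_ring G) (F 0) trivial_module \<and>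
    (\<forall>i<n. d (Suc i) \<in> mod_hom (group_ring G) (F (Suc i)) (F i)) \<and>
    \<epsilon> ` carrier (F 0) = UNIV \<and>
    (0 < n \<longrightarrow> d 1 ` carrier (F 1) = mod_ker (F 0) trivial_module \<epsilon>) \<and>
    (\<forall>i. Suc i < n \<longrightarrow>
      d (Suc (Suc i)) ` carrier (F (Suc (Suc i))) = mod_ker (F (Suc i)) (F i) (d (Suc i)))"

text \<open>The modules in the definition of type \<open>FP\<^sub>n\<close> are taken with elements of type
  \<open>nat \<Rightarrow> \<int>[G]\<close>.  This is no restriction: a finitely generated projective module is isomorphic to a
  submodule of some \<open>\<int>[G]\<^sup>m\<close>.\<close>

definition type_FP :: "('g, 'x) monoid_scheme \<Rightarrow> nat \<Rightarrow> bool"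
  where "type_FP G n \<longleftrightarrow>
    (\<exists>(F :: nat \<Rightarrow> ('g \<Rightarrow>\<^sub>0 int, nat \<Rightarrow> 'g \<Rightarrow>\<^sub>0 int) module) d \<epsilon>.
      (\<forall>i\<le>n. projective_module (group_ring G) (F i) \<and> fin_gen_module (group_ring G) (F i)) \<and>
      exact_augmented G n F d \<epsilon>)"

definition projective_resolution ::
  "('g, 'x) monoid_scheme \<Rightarrow> (nat \<Rightarrow> ('g \<Rightarrow>\<^sub>0 int, 'a) module) \<Rightarrow> (nat \<Rightarrow> 'a \<Rightarrow> 'a) \<Rightarrow> ('a \<Rightarrow> int) \<Rightarrow> bool"
  where "projective_resolution G F d \<epsilon> \<longleftrightarrow>
    (\<forall>i. projective_module (group_ring G) (F i)) \<and> (\<forall>n. exact_augmented G n F d \<epsilon>)"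

definition group_center :: "('g, 'x) monoid_scheme \<Rightarrow> 'g set"
  where "group_center G = {z \<in> carrier G. \<forall>g\<in>carrier G. z \<otimes>\<^bsub>G\<^esub> g = g \<otimes>\<^bsub>G\<^esub> z}"

definition infinite_order :: "('g, 'x) monoid_scheme \<Rightarrow> 'g \<Rightarrow> bool"
  where "infinite_order G z \<longleftrightarrow> (\<forall>k::nat. k > 0 \<longrightarrow> z [^]\<^bsub>G\<^esub> k \<noteq> \<one>\<^bsub>G\<^esub>)"

section \<open>The \<open>\<int>[G]\<close>-module \<open>l\<^sup>p(G)\<close>\<close>

text \<open>Formal sums \<open>\<Sum>\<^sub>g f\<^sub>g g\<close> are functions vanishing outside \<open>carrier G\<close>; countability of the support
  follows from summability.\<close>

definition lp_space :: "('g, 'x) monoid_scheme \<Rightarrow> real \<Rightarrow> ('g \<Rightarrow> complex) set"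
  where "lp_space G p = {f. (\<forall>g. g \<notin> carrier G \<longrightarrow> f g = 0) \<and>
                            (\<lambda>g. cmod (f g) powr p) summable_on carrier G}"

definition lp_norm :: "('g, 'x) monoid_scheme \<Rightarrow> real \<Rightarrow> ('g \<Rightarrow> complex) \<Rightarrow> real"
  where "lp_norm G p f = (\<Sum>\<^sub>\<infinity>g\<in>carrier G. cmod (f g) powr p) powr (1 / p)"

definition lp_topology :: "('g, 'x) monoid_scheme \<Rightarrow> real \<Rightarrow> ('g \<Rightarrow> complex) topology"
  where "lp_topology G p = Metric_space.mtopology (lp_space G p) (\<lambda>f h. lp_norm G p (\<lambda>g. f g - h g))"

text \<open>Left translation: \<open>g \<cdot> \<Sum>\<^sub>k f\<^sub>k k = \<Sum>\<^sub>k f\<^sub>k g k\<close> has coefficient \<open>f (g\<^sup>-\<^sup>1 h)\<close> at \<open>h\<close>.\<close>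

definition lp_module :: "('g, 'x) monoid_scheme \<Rightarrow> real \<Rightarrow> ('g \<Rightarrow>\<^sub>0 int, 'g \<Rightarrow> complex) module"
  where "lp_module G p = \<lparr>
    carrier = lp_space G p, monoid.mult = undefined, one = undefined,
    ring.zero = (\<lambda>g. 0), ring.add = (\<lambda>f h g. f g + h g),
    module.smult = (\<lambda>a f h. if h \<in> carrier G
      then (\<Sum>g\<in>Poly_Mapping.keys a. of_int (Poly_Mapping.lookup a g) * f (inv\<^bsub>G\<^esub> g \<otimes>\<^bsub>G\<^esub> h))
      else 0)\<rparr>"

section \<open>Tensor products over \<open>\<int>[G]\<close>\<close>

text \<open>\<open>M \<otimes> N\<close> is the free abelian group on \<open>M \<times> N\<close> modulo the subgroup \<open>tensor_rel G M N\<close>; its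
  elements are cosets.  It is a group in multiplicative notation.\<close>

abbreviation tensor_free ::
  "('r, 'a, 'y) module_scheme \<Rightarrow> ('r, 'b, 'z) module_scheme \<Rightarrow> ('a \<times> 'b \<Rightarrow>\<^sub>0 int) monoid"
  where "tensor_free M N \<equiv> free_Abelian_group (carrier M \<times> carrier N)"

definition tensor_rel ::
  "('g, 'x) monoid_scheme \<Rightarrow> ('g \<Rightarrow>\<^sub>0 int, 'a, 'y) module_scheme \<Rightarrow> ('g \<Rightarrow>\<^sub>0 int, 'b, 'z) module_scheme
    \<Rightarrow> ('a \<times> 'b \<Rightarrow>\<^sub>0 int) set"
  where "tensor_rel G M N = generate (tensor_free M N)
    ({frag_of (x \<oplus>\<^bsub>M\<^esub> x', f) - frag_of (x, f) - frag_of (x', f) | x x' f.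
        x \<in> carrier M \<and> x' \<in> carrier M \<and> f \<in> carrier N} \<union>
     {frag_of (x, f \<oplus>\<^bsub>N\<^esub> f') - frag_of (x, f) - frag_of (x, f') | x f f'.
        x \<in> carrier M \<and> f \<in> carrier N \<and> f' \<in> carrier N} \<union>
     {frag_of (group_ring_star G a \<odot>\<^bsub>M\<^esub> x, f) - frag_of (x, a \<odot>\<^bsub>N\<^esub> f) | a x f.
        a \<in> carrier (group_ring G) \<and> x \<in> carrier M \<and> f \<in> carrier N})"

definition tensor ::
  "('g, 'x) monoid_scheme \<Rightarrow> ('g \<Rightarrow>\<^sub>0 int, 'a, 'y) module_scheme \<Rightarrow> ('g \<Rightarrow>\<^sub>0 int, 'b, 'z) module_scheme
    \<Rightarrow> ('a \<times> 'b \<Rightarrow>\<^sub>0 int) set monoid"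
  where "tensor G M N = tensor_free M N Mod tensor_rel G M N"

text \<open>The map \<open>d \<otimes> 1 : M \<otimes> N \<rightarrow> M' \<otimes> N\<close>.  For a module homomorphism \<open>d\<close> all \<open>c\<close> in a coset \<open>C\<close> are
  sent to the same coset, so the union is over equal sets.\<close>

definition tensor_map ::
  "('g, 'x) monoid_scheme \<Rightarrow> ('g \<Rightarrow>\<^sub>0 int, 'a', 'y) module_scheme \<Rightarrow> ('g \<Rightarrow>\<^sub>0 int, 'b, 'z) module_scheme
    \<Rightarrow> ('a \<Rightarrow> 'a') \<Rightarrow> ('a \<times> 'b \<Rightarrow>\<^sub>0 int) set \<Rightarrow> ('a' \<times> 'b \<Rightarrow>\<^sub>0 int) set"
  where "tensor_map G M' N d C =
    (\<Union>c\<in>C. tensor_rel G M' N #>\<^bsub>tensor_free M' N\<^esub> frag_extend (\<lambda>(x, f). frag_of (d x, f)) c)"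

text \<open>The element \<open>\<Sum>\<^sub>j\<^sub><\<^sub>m x\<^sub>j \<otimes> f\<^sub>j\<close>.\<close>

definition tensor_sum ::
  "('g, 'x) monoid_scheme \<Rightarrow> ('g \<Rightarrow>\<^sub>0 int, 'a, 'y) module_scheme \<Rightarrow> ('g \<Rightarrow>\<^sub>0 int, 'b, 'z) module_scheme
    \<Rightarrow> nat \<Rightarrow> (nat \<Rightarrow> 'a) \<Rightarrow> (nat \<Rightarrow> 'b) \<Rightarrow> ('a \<times> 'b \<Rightarrow>\<^sub>0 int) set"
  where "tensor_sum G M N m x f =
    tensor_rel G M N #>\<^bsub>tensor_free M N\<^esub> (\<Sum>j<m. frag_of (x j, f j))"

text \<open>The topology of \<open>F \<otimes> l\<^sup>p(G)\<close> for finitely generated \<open>F\<close>: the final topology for all maps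
  \<open>l\<^sup>p(G)\<^sup>m \<rightarrow> F \<otimes> l\<^sup>p(G)\<close>, \<open>(f\<^sub>j) \<mapsto> \<Sum>\<^sub>j x\<^sub>j \<otimes> f\<^sub>j\<close>, with \<open>x\<^sub>1, \<dots>, x\<^sub>m \<in> F\<close>.  If \<open>x\<^sub>1, \<dots>, x\<^sub>m\<close> generate \<open>F\<close>, all
  maps of this kind factor continuously through the one belonging to \<open>x\<close>, so this is the quotient
  topology of \<open>l\<^sup>p(G)\<^sup>m\<close>; if they form a basis, that map is a homeomorphism from \<open>l\<^sup>p(G)\<^sup>m\<close>.  If \<open>F\<close> is a
  direct summand of \<open>\<int>[G]\<^sup>m\<close>, the topology is the one of the direct summand \<open>F \<otimes> l\<^sup>p(G)\<close> of
  \<open>l\<^sup>p(G)\<^sup>m\<close>.\<close>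

definition tensor_lp_topology ::
  "('g, 'x) monoid_scheme \<Rightarrow> real \<Rightarrow> ('g \<Rightarrow>\<^sub>0 int, 'a, 'y) module_scheme
    \<Rightarrow> ('a \<times> ('g \<Rightarrow> complex) \<Rightarrow>\<^sub>0 int) set topology"
  where "tensor_lp_topology G p F = topology (\<lambda>U.
    U \<subseteq> carrier (tensor G F (lp_module G p)) \<and>
    (\<forall>(m::nat) x. x \<in> {..<m} \<rightarrow> carrier F \<longrightarrow>
      openin (product_topology (\<lambda>j. lp_topology G p) {..<m})
        {f \<in> {..<m} \<rightarrow>\<^sub>E lp_space G p. tensor_sum G F (lp_module G p) m x f \<in> U}))"

section \<open>Homomorphisms into \<open>l\<^sup>p(G)\<close>\<close>

text \<open>Homomorphisms are represented by extensional functions, so that equality of functions is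
  equality on the carrier.\<close>

definition Hom_group ::
  "('r, 'x) ring_scheme \<Rightarrow> ('r, 'a, 'y) module_scheme \<Rightarrow> ('r, 'b, 'z) module_scheme \<Rightarrow> ('a \<Rightarrow> 'b) monoid"
  where "Hom_group R M N = \<lparr>
    carrier = mod_hom R M N \<inter> extensional (carrier M),
    monoid.mult = (\<lambda>\<phi> \<psi>. \<lambda>x\<in>carrier M. \<phi> x \<oplus>\<^bsub>N\<^esub> \<psi> x),
    one = (\<lambda>x\<in>carrier M. \<zero>\<^bsub>N\<^esub>)\<rparr>"

text \<open>The topology of pointwise convergence in \<open>l\<^sup>p(G)\<close>.  If \<open>x\<^sub>1, \<dots>, x\<^sub>m\<close> generate \<open>F\<close>, then
  \<open>\<phi> \<mapsto> (\<phi> x\<^sub>1, \<dots>, \<phi> x\<^sub>m)\<close> is a homeomorphism onto a closed subspace of \<open>l\<^sup>p(G)\<^sup>m\<close>, and onto all of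
  \<open>l\<^sup>p(G)\<^sup>m\<close> if they form a basis.\<close>

definition Hom_lp_topology ::
  "('g, 'x) monoid_scheme \<Rightarrow> real \<Rightarrow> ('g \<Rightarrow>\<^sub>0 int, 'a, 'y) module_scheme \<Rightarrow> ('a \<Rightarrow> 'g \<Rightarrow> complex) topology"
  where "Hom_lp_topology G p F =
    subtopology (product_topology (\<lambda>x. lp_topology G p) (carrier F))
      (carrier (Hom_group (group_ring G) F (lp_module G p)))"

section \<open>Reduced \<open>l\<^sup>p\<close>-homology and \<open>l\<^sup>p\<close>-cohomology\<close>

definition lp_cycles ::
  "('g, 'x) monoid_scheme \<Rightarrow> real \<Rightarrow> (nat \<Rightarrow> ('g \<Rightarrow>\<^sub>0 int, 'a) module) \<Rightarrow> (nat \<Rightarrow> 'a \<Rightarrow> 'a) \<Rightarrow> nat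
    \<Rightarrow> ('a \<times> ('g \<Rightarrow> complex) \<Rightarrow>\<^sub>0 int) set set"
  where "lp_cycles G p F d i = (case i of
      0 \<Rightarrow> carrier (tensor G (F 0) (lp_module G p))
    | Suc k \<Rightarrow> kernel (tensor G (F (Suc k)) (lp_module G p)) (tensor G (F k) (lp_module G p))
                 (tensor_map G (F k) (lp_module G p) (d (Suc k))))"

definition lp_boundaries ::
  "('g, 'x) monoid_scheme \<Rightarrow> real \<Rightarrow> (nat \<Rightarrow> ('g \<Rightarrow>\<^sub>0 int, 'a) module) \<Rightarrow> (nat \<Rightarrow> 'a \<Rightarrow> 'a) \<Rightarrow> nat
    \<Rightarrow> ('a \<times> ('g \<Rightarrow> complex) \<Rightarrow>\<^sub>0 int) set set"
  where "lp_boundaries G p F d i =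
    tensor_map G (F i) (lp_module G p) (d (Suc i)) ` carrier (tensor G (F (Suc i)) (lp_module G p))"

definition reduced_lp_homology ::
  "('g, 'x) monoid_scheme \<Rightarrow> real \<Rightarrow> (nat \<Rightarrow> ('g \<Rightarrow>\<^sub>0 int, 'a) module) \<Rightarrow> (nat \<Rightarrow> 'a \<Rightarrow> 'a) \<Rightarrow> nat
    \<Rightarrow> ('a \<times> ('g \<Rightarrow> complex) \<Rightarrow>\<^sub>0 int) set set monoid"
  where "reduced_lp_homology G p F d i =
    (tensor G (F i) (lp_module G p)\<lparr>carrier := lp_cycles G p F d i\<rparr>) Mod
    (tensor_lp_topology G p (F i) closure_of lp_boundaries G p F d i)"

definition lp_cocycles ::
  "('g, 'x) monoid_scheme \<Rightarrow> real \<Rightarrow> (nat \<Rightarrow> ('g \<Rightarrow>\<^sub>0 int, 'a) module) \<Rightarrow> (nat \<Rightarrow> 'a \<Rightarrow> 'a) \<Rightarrow> nat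
    \<Rightarrow> ('a \<Rightarrow> 'g \<Rightarrow> complex) set"
  where "lp_cocycles G p F d i =
    kernel (Hom_group (group_ring G) (F i) (lp_module G p))
           (Hom_group (group_ring G) (F (Suc i)) (lp_module G p))
           (\<lambda>\<phi>. compose (carrier (F (Suc i))) \<phi> (d (Suc i)))"

definition lp_coboundaries ::
  "('g, 'x) monoid_scheme \<Rightarrow> real \<Rightarrow> (nat \<Rightarrow> ('g \<Rightarrow>\<^sub>0 int, 'a) module) \<Rightarrow> (nat \<Rightarrow> 'a \<Rightarrow> 'a) \<Rightarrow> nat
    \<Rightarrow> ('a \<Rightarrow> 'g \<Rightarrow> complex) set"
  where "lp_coboundaries G p F d i = (case i of
      0 \<Rightarrow> {\<one>\<^bsub>Hom_group (group_ring G) (F 0) (lp_module G p)\<^esub>}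
    | Suc k \<Rightarrow> (\<lambda>\<phi>. compose (carrier (F (Suc k))) \<phi> (d (Suc k))) `
                 carrier (Hom_group (group_ring G) (F k) (lp_module G p)))"

definition reduced_lp_cohomology ::
  "('g, 'x) monoid_scheme \<Rightarrow> real \<Rightarrow> (nat \<Rightarrow> ('g \<Rightarrow>\<^sub>0 int, 'a) module) \<Rightarrow> (nat \<Rightarrow> 'a \<Rightarrow> 'a) \<Rightarrow> nat
    \<Rightarrow> ('a \<Rightarrow> 'g \<Rightarrow> complex) set monoid"
  where "reduced_lp_cohomology G p F d i =
    (Hom_group (group_ring G) (F i) (lp_module G p)\<lparr>carrier := lp_cocycles G p F d i\<rparr>) Mod
    (Hom_lp_topology G p (F i) closure_of lp_coboundaries G p F d i)"

end

theory Submission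
  imports Defs
begin

text \<open>
  Let \<open>z\<close> be a central element of infinite order. Multiplication by \<open>z - 1\<close> is a chain map of the
  resolution which lifts the zero map of \<open>\<int>\<close>, so it is null-homotopic, and \<open>(z - 1) c\<close> is a boundary
  for every cycle \<open>c\<close>. On the other hand \<open>z - 1\<close> has dense range in \<open>l\<^sup>p(G)\<close> for \<open>p > 1\<close>: with
  \<open>A\<^sub>N = (1 + z + \<dots> + z\<^sup>N\<^sup>-\<^sup>1) / N\<close> one has \<open>1 - A\<^sub>N = (z - 1) Q\<^sub>N\<close> for some \<open>Q\<^sub>N \<in> \<complex>[z]\<close>, and
  \<open>A\<^sub>N f\<close> tends to \<open>0\<close>, because \<open>A\<^sub>N\<close> is a contraction that sends a point mass to a function of norm
  \<open>N\<^sup>1\<^sup>/\<^sup>p\<^sup>-\<^sup>1\<close>. As \<open>z\<close> is central, \<open>Q\<^sub>N\<close> commutes with the action of \<open>G\<close>, so every cycle \<open>c\<close> is the limit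
  of the boundaries \<open>(z - 1) Q\<^sub>N c\<close>; the same argument applies to cocycles.
\<close>

section \<open>The space \<open>l\<^sup>p(G)\<close>\<close>

text \<open>The condition \<open>p > 1\<close> enters through the negative exponent in
  \<open>N powr (1 / p - 1)\<close>; for \<open>p = 1\<close> the averages of a point mass keep norm
  1. The operator \<open>Q N\<close> comes from averaging
  \<open>1 - z^k = (1 - z) (1 + z + ... + z^(k-1))\<close> over \<open>k < N\<close>: the power
  \<open>z^l\<close> occurs for the \<open>N - 1 - l\<close> values of \<open>k\<close> with
  \<open>l < k < N\<close>, so its coefficient is \<open>- (N - 1 - l) / N\<close>. No convergence
  of \<open>Q N\<close> is claimed, so a class is only reached as a limit of boundaries, which is
  why the conclusion concerns reduced groups. The coefficients of \<open>Q N\<close> are rational,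
  hence \<open>Q N\<close> is not multiplication by an element of the integral group ring. It acts
  on \<open>l^p(G)\<close> as a module endomorphism instead, and so passes through
  \<open>Hom\<close> and the tensor product. In a tensor product, \<open>z - 1\<close> acting on the
  resolution becomes \<open>inv z - 1\<close> on \<open>l^p(G)\<close>, so homology uses the ergodic
  theorem for \<open>inv z\<close>. The quotients are handled with continuity of each translation
  separately, which is easy to verify for both topologies; joint continuity of addition is never
  established.\<close>

lemma powr_convex_nonneg:
  fixes p x y t :: real
  assumes "p \<ge> 1" "x \<ge> 0" "y \<ge> 0" "0 \<le> t" "t \<le> 1"
  shows "((1 - t) * x + t * y) powr p \<le> (1 - t) * x powr p + t * y powr p"
proof -
  \<comment> \<open>If one of the two points is 0, the claim reduces to
    \<open>s powr p \<le> s\<close> on the unit interval; convexity of \<open>powr\<close> is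
    invoked only for two positive points.\<close>
  have scale: "(s * u) powr p \<le> s * u powr p" if "0 \<le> s" "s \<le> 1" "0 \<le> u" for s u :: real
  proof -
    have "s powr p \<le> s"
      using that assms(1) powr_mono'[of 1 p s] by simp
    with that show ?thesis
      by (simp add: powr_mult mult_right_mono)
  qed
  consider "x = 0" | "y = 0" | "x > 0" "y > 0" using assms by linarith
  then show ?thesis
  proof cases
    case 1
    then show ?thesis using scale[of t y] assms by simp
  next
    case 2
    then show ?thesis using scale[of "1 - t" x] assms by simp
  next
    case 3
    then show ?thesis
      using convex_onD[OF powr_convex[OF assms(1)], of t x y] assms by simp
  qed
qed

section \<open>Norm estimates, Minkowski's inequality and the metric of
  \<open>l^p(G)\<close>\<close>

lemma lp_spaceD: "f \<in> lp_space G p \<Longrightarrow> g \<notin> carrier G \<Longrightarrow> f g = 0"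
  by (simp add: lp_space_def)

lemma lp_norm_nonneg [simp]: "0 \<le> lp_norm G p f"
  by (simp add: lp_norm_def)

text \<open>A family of nonnegative terms is summable as soon as its finite partial sums are
  bounded. Membership and norm bound therefore come from the same estimate on finite sets, and the
  later norm estimates are all reduced to that form.\<close>

lemma lp_normI:
  assumes p: "p \<ge> 1" and "C \<ge> 0"
    and f: "\<And>g. g \<notin> carrier G \<Longrightarrow> f g = 0"
    and bound: "\<And>S. finite S \<Longrightarrow> S \<subseteq> carrier G \<Longrightarrow> (\<Sum>g\<in>S. cmod (f g) powr p) \<le> C powr p"
  shows "f \<in> lp_space G p" and "lp_norm G p f \<le> C"
proof -
  have sm: "(\<lambda>g. cmod (f g) powr p) summable_on carrier G"
    by (rule nonneg_bdd_above_summable_on) (auto intro!: bdd_aboveI[where M = "C powr p"] bound)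
  then show "f \<in> lp_space G p" using f by (simp add: lp_space_def)
  have "(\<Sum>\<^sub>\<infinity>g\<in>carrier G. cmod (f g) powr p) \<le> C powr p"
    by (rule infsum_le_finite_sums[OF sm]) (auto intro: bound)
  then have "lp_norm G p f \<le> (C powr p) powr (1 / p)"
    unfolding lp_norm_def using p by (intro powr_mono2) (auto intro!: infsum_nonneg)
  also have "\<dots> = C" using p \<open>C \<ge> 0\<close> by (simp add: powr_powr)
  finally show "lp_norm G p f \<le> C" .
qed

lemma lp_norm_powr:
  assumes "p > 0"
  shows "lp_norm G p f powr p = (\<Sum>\<^sub>\<infinity>g\<in>carrier G. cmod (f g) powr p)"
  using assms unfolding lp_norm_def by (simp add: powr_powr infsum_nonneg)

lemma lp_norm_finite_sum_le:
  assumes p: "p \<ge> 1" and f: "f \<in> lp_space G p" and C: "lp_norm G p f \<le> C"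
    and S: "finite S" "S \<subseteq> carrier G"
  shows "(\<Sum>g\<in>S. cmod (f g) powr p) \<le> C powr p"
proof -
  have "(\<Sum>g\<in>S. cmod (f g) powr p) \<le> lp_norm G p f powr p"
    unfolding lp_norm_powr[OF less_le_trans[OF zero_less_one p]]
    using f S by (intro finite_sum_le_infsum) (auto simp: lp_space_def)
  also have "\<dots> \<le> C powr p"
    using p C by (intro powr_mono2) auto
  finally show ?thesis .
qed

text \<open>Minkowski's inequality from convexity alone: for \<open>A\<close> and \<open>B\<close>
  bounding the two norms, the sum is \<open>A + B\<close> times a convex combination of
  \<open>f / A\<close> and \<open>h / B\<close> with weights \<open>A / (A + B)\<close> and
  \<open>B / (A + B)\<close>, and convexity of the p-th power is applied pointwise.\<close>

lemma lp_add:
  assumes p: "p \<ge> 1" and f: "f \<in> lp_space G p" and h: "h \<in> lp_space G p"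
  shows lp_add_closed: "(\<lambda>g. f g + h g) \<in> lp_space G p"
    and lp_norm_triangle: "lp_norm G p (\<lambda>g. f g + h g) \<le> lp_norm G p f + lp_norm G p h"
proof -
  \<comment> \<open>Strictly positive upper bounds take the place of the norms, since a norm may be
    0 and cannot be divided by. Membership then follows with norm plus 1, the inequality with norm
    plus \<open>e / 2\<close>.\<close>
  have *: "(\<lambda>g. f g + h g) \<in> lp_space G p \<and> lp_norm G p (\<lambda>g. f g + h g) \<le> A + B"
    if A: "A > 0" "lp_norm G p f \<le> A" and B: "B > 0" "lp_norm G p h \<le> B" for A B
  proof -
    define t where "t = B / (A + B)"
    have t: "0 \<le> t" "t \<le> 1" "1 - t = A / (A + B)"
      using A B by (auto simp: t_def field_simps)
    have pt: "cmod (f g + h g) powr p \<le>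
        (A + B) powr p * ((1 - t) * (cmod (f g) powr p / A powr p) + t * (cmod (h g) powr p / B powr p))" for g
    proof -
      have "cmod (f g + h g) powr p \<le> (cmod (f g) + cmod (h g)) powr p"
        using p by (intro powr_mono2) (auto intro: norm_triangle_ineq)
      also have "cmod (f g) + cmod (h g) = (A + B) * ((1 - t) * (cmod (f g) / A) + t * (cmod (h g) / B))"
        unfolding t(3) unfolding t_def using A B by (simp add: distrib_left)
      also have "\<dots> powr p = (A + B) powr p * ((1 - t) * (cmod (f g) / A) + t * (cmod (h g) / B)) powr p"
        using A B t by (intro powr_mult)
      also have "\<dots> \<le> (A + B) powr p * ((1 - t) * (cmod (f g) / A) powr p + t * (cmod (h g) / B) powr p)"
        using A B t p by (intro mult_left_mono powr_convex_nonneg) auto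
      finally show ?thesis using A B by (simp add: powr_divide)
    qed
    have bound: "(\<Sum>g\<in>S. cmod (f g + h g) powr p) \<le> (A + B) powr p"
      if S: "finite S" "S \<subseteq> carrier G" for S
    proof -
      have 1: "(\<Sum>g\<in>S. cmod (f g) powr p) / A powr p \<le> 1"
        using lp_norm_finite_sum_le[OF p f A(2) S] A(1) by simp
      have 2: "(\<Sum>g\<in>S. cmod (h g) powr p) / B powr p \<le> 1"
        using lp_norm_finite_sum_le[OF p h B(2) S] B(1) by simp
      have "(\<Sum>g\<in>S. cmod (f g + h g) powr p) \<le>
          (A + B) powr p * ((1 - t) * ((\<Sum>g\<in>S. cmod (f g) powr p) / A powr p)
             + t * ((\<Sum>g\<in>S. cmod (h g) powr p) / B powr p))"
        by (rule order_trans[OF sum_mono[OF pt]])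
          (simp add: sum.distrib sum_distrib_left sum_divide_distrib distrib_left)
      also have "\<dots> \<le> (A + B) powr p * ((1 - t) * 1 + t * 1)"
        using 1 2 t by (intro mult_left_mono add_mono) auto
      finally show ?thesis by simp
    qed
    show ?thesis
      using lp_normI[where G = G and C = "A + B", OF p _ _ bound] A B lp_spaceD[OF f] lp_spaceD[OF h] by auto
  qed
  have pos: "lp_norm G p f + 1 > 0" "lp_norm G p h + 1 > 0"
    by (auto intro: add_nonneg_pos)
  show "(\<lambda>g. f g + h g) \<in> lp_space G p"
    using *[OF pos(1) _ pos(2)] by simp
  show "lp_norm G p (\<lambda>g. f g + h g) \<le> lp_norm G p f + lp_norm G p h"
  proof (rule field_le_epsilon)
    fix e :: real
    assume "e > 0"
    then show "lp_norm G p (\<lambda>g. f g + h g) \<le> lp_norm G p f + lp_norm G p h + e"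
      using *[of "lp_norm G p f + e / 2" "lp_norm G p h + e / 2"]
        lp_norm_nonneg[of G p f] lp_norm_nonneg[of G p h]
      by (auto simp del: lp_norm_nonneg)
  qed
qed

lemma lp_zero:
  assumes "p \<ge> 1"
  shows "(\<lambda>g. 0) \<in> lp_space G p" "lp_norm G p (\<lambda>g. 0) = 0"
  using assms by (auto simp: lp_space_def lp_norm_def)

lemma lp_scale:
  assumes p: "p \<ge> 1" and f: "f \<in> lp_space G p"
  shows "(\<lambda>g. c * f g) \<in> lp_space G p"
    and "lp_norm G p (\<lambda>g. c * f g) \<le> cmod c * lp_norm G p f"
proof -
  have "(\<Sum>g\<in>S. cmod (c * f g) powr p) \<le> (cmod c * lp_norm G p f) powr p"
    if "finite S" "S \<subseteq> carrier G" for S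
  proof -
    have "(\<Sum>g\<in>S. cmod (c * f g) powr p) = cmod c powr p * (\<Sum>g\<in>S. cmod (f g) powr p)"
      by (simp add: norm_mult powr_mult sum_distrib_left)
    also have "\<dots> \<le> cmod c powr p * lp_norm G p f powr p"
      using lp_norm_finite_sum_le[OF p f order_refl that] by (intro mult_left_mono) auto
    finally show ?thesis by (simp add: powr_mult)
  qed
  from lp_normI[OF p _ _ this] show "(\<lambda>g. c * f g) \<in> lp_space G p"
    "lp_norm G p (\<lambda>g. c * f g) \<le> cmod c * lp_norm G p f"
    using lp_spaceD[OF f] by auto
qed

text \<open>This one estimate serves the group ring action, the ergodic averages, the operators
  \<open>Q N\<close> and finite sums of point masses.\<close>

lemma lp_linear_combination:
  assumes p: "p \<ge> 1" and "finite I" and "\<And>i. i \<in> I \<Longrightarrow> f i \<in> lp_space G p"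
  shows "(\<lambda>g. \<Sum>i\<in>I. c i * f i g) \<in> lp_space G p \<and>
         lp_norm G p (\<lambda>g. \<Sum>i\<in>I. c i * f i g) \<le> (\<Sum>i\<in>I. cmod (c i) * lp_norm G p (f i))"
  using assms(2,3)
proof (induction I rule: finite_induct)
  case empty
  then show ?case by (simp add: lp_zero[OF p])
next
  case (insert i I)
  have i: "(\<lambda>g. c i * f i g) \<in> lp_space G p"
    "lp_norm G p (\<lambda>g. c i * f i g) \<le> cmod (c i) * lp_norm G p (f i)"
    using lp_scale[OF p insert.prems[OF insertI1]] by auto
  have I: "(\<lambda>g. \<Sum>i\<in>I. c i * f i g) \<in> lp_space G p"
    "lp_norm G p (\<lambda>g. \<Sum>i\<in>I. c i * f i g) \<le> (\<Sum>i\<in>I. cmod (c i) * lp_norm G p (f i))"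
    using insert by auto
  show ?case
    using lp_add[OF p i(1) I(1)] i(2) I(2) insert.hyps by auto
qed

lemma lp_diff_closed:
  assumes "p \<ge> 1" "f \<in> lp_space G p" "h \<in> lp_space G p"
  shows "(\<lambda>g. f g - h g) \<in> lp_space G p"
  using lp_add_closed[OF assms(1,2) lp_scale(1)[OF assms(1,3), of "-1"]] by simp

lemma lp_Metric_space:
  assumes p: "p \<ge> 1"
  shows "Metric_space (lp_space G p) (\<lambda>f h. lp_norm G p (\<lambda>g. f g - h g))"
proof
  fix f h k
  show "0 \<le> lp_norm G p (\<lambda>g. f g - h g)" by simp
  show "lp_norm G p (\<lambda>g. f g - h g) = lp_norm G p (\<lambda>g. h g - f g)"
    by (simp add: lp_norm_def norm_minus_commute)
  assume f: "f \<in> lp_space G p" and h: "h \<in> lp_space G p"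
  have fh: "(\<lambda>g. f g - h g) \<in> lp_space G p"
    using lp_diff_closed[OF p f h] .
  show "lp_norm G p (\<lambda>g. f g - h g) = 0 \<longleftrightarrow> f = h"
  proof
    assume 0: "lp_norm G p (\<lambda>g. f g - h g) = 0"
    show "f = h"
    proof
      fix g
      show "f g = h g"
      proof (cases "g \<in> carrier G")
        case True
        then have "cmod (f g - h g) powr p \<le> 0"
          using lp_norm_finite_sum_le[OF p fh, of 0 "{g}"] 0 by simp
        then show ?thesis by simp
      qed (simp add: lp_spaceD[OF f] lp_spaceD[OF h])
    qed
  qed (simp add: lp_zero[OF p])
  assume k: "k \<in> lp_space G p"
  have "lp_norm G p (\<lambda>g. (f g - h g) + (h g - k g)) \<le>
      lp_norm G p (\<lambda>g. f g - h g) + lp_norm G p (\<lambda>g. h g - k g)"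
    by (rule lp_norm_triangle[OF p fh lp_diff_closed[OF p h k]])
  then show "lp_norm G p (\<lambda>g. f g - k g) \<le>
      lp_norm G p (\<lambda>g. f g - h g) + lp_norm G p (\<lambda>g. h g - k g)"
    by simp
qed

lemma topspace_lp_topology [simp]: "p \<ge> 1 \<Longrightarrow> topspace (lp_topology G p) = lp_space G p"
  unfolding lp_topology_def using Metric_space.topspace_mtopology[OF lp_Metric_space] .

lemma limitin_lp_topology:
  assumes "p \<ge> 1"
  shows "limitin (lp_topology G p) f l F \<longleftrightarrow> l \<in> lp_space G p \<and>
    (\<forall>e>0. eventually (\<lambda>x. f x \<in> lp_space G p \<and> lp_norm G p (\<lambda>g. f x g - l g) < e) F)"
  unfolding lp_topology_def using Metric_space.limitin_metric[OF lp_Metric_space[OF assms]] .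

text \<open>Adding \<open>k\<close> does not change differences, so the map is an isometry and delta
  can be taken equal to epsilon.\<close>

lemma continuous_map_lp_translation:
  assumes p: "p \<ge> 1" and k: "k \<in> lp_space G p"
  shows "continuous_map (lp_topology G p) (lp_topology G p) (\<lambda>f g. f g + k g)"
proof -
  interpret Metric_space "lp_space G p" "\<lambda>f h. lp_norm G p (\<lambda>g. f g - h g)"
    by (rule lp_Metric_space[OF p])
  show ?thesis
    unfolding lp_topology_def
    by (subst metric_continuous_map[OF lp_Metric_space[OF p]])
      (auto intro!: lp_add_closed[OF p] k exI)
qed

section \<open>Translations by group elements and ergodic averages\<close>

definition lp_translate :: "('g, 'x) monoid_scheme \<Rightarrow> 'g \<Rightarrow> ('g \<Rightarrow> complex) \<Rightarrow> 'g \<Rightarrow> complex"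
  where "lp_translate G g f = (\<lambda>h. if h \<in> carrier G then f (inv\<^bsub>G\<^esub> g \<otimes>\<^bsub>G\<^esub> h) else 0)"

lemma (in group) bij_betw_left_mult:
  "g \<in> carrier G \<Longrightarrow> bij_betw (\<lambda>h. g \<otimes> h) (carrier G) (carrier G)"
  by (rule bij_betwI[where g = "\<lambda>h. inv g \<otimes> h"]) (auto simp: m_assoc[symmetric])

lemma (in group) lp_translate_closed:
  assumes "f \<in> lp_space G p" "g \<in> carrier G"
  shows "lp_translate G g f \<in> lp_space G p"
    and "lp_norm G p (lp_translate G g f) = lp_norm G p f"
proof -
  note b = bij_betw_left_mult[OF inv_closed[OF assms(2)]]
  show "lp_translate G g f \<in> lp_space G p"
    using assms(1) summable_on_reindex_bij_betw[OF b, of "\<lambda>h. cmod (f h) powr p"]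
    by (auto simp: lp_space_def lp_translate_def cong: summable_on_cong)
  show "lp_norm G p (lp_translate G g f) = lp_norm G p f"
    using infsum_reindex_bij_betw[OF b, of "\<lambda>h. cmod (f h) powr p"]
    by (auto simp: lp_norm_def lp_translate_def cong: infsum_cong)
qed

lemma (in group) lp_translate_mult:
  assumes "g \<in> carrier G" "g' \<in> carrier G"
  shows "lp_translate G g (lp_translate G g' f) = lp_translate G (g \<otimes> g') f"
  using assms by (auto simp: lp_translate_def inv_mult_group m_assoc)

lemma (in group) lp_translate_one: "f \<in> lp_space G p \<Longrightarrow> lp_translate G \<one> f = f"
  by (auto simp: lp_translate_def lp_space_def)

lemma lp_translate_linear_combination:
  "lp_translate G g (\<lambda>h. \<Sum>i\<in>I. c i * f i h) = (\<lambda>h. \<Sum>i\<in>I. c i * lp_translate G g (f i) h)"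
  by (auto simp: lp_translate_def)

lemma lp_translate_add:
  "lp_translate G g (\<lambda>h. f h + k h) = (\<lambda>h. lp_translate G g f h + lp_translate G g k h)"
  by (auto simp: lp_translate_def)

lemma lp_module_smult:
  "a \<odot>\<^bsub>lp_module G p\<^esub> f =
    (\<lambda>h. \<Sum>g\<in>Poly_Mapping.keys a. of_int (Poly_Mapping.lookup a g) * lp_translate G g f h)"
  by (auto simp: lp_module_def lp_translate_def)

text \<open>The mean \<open>A\<^sub>N\<close> of the overview, for the element
  \<open>w\<close>.\<close>

definition lp_average :: "('g, 'x) monoid_scheme \<Rightarrow> 'g \<Rightarrow> nat \<Rightarrow> ('g \<Rightarrow> complex) \<Rightarrow> 'g \<Rightarrow> complex"
  where "lp_average G w N f = (\<lambda>h. \<Sum>l<N. (1 / of_nat N) * lp_translate G (w [^]\<^bsub>G\<^esub> l) f h)"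

context group begin

lemma lp_average:
  assumes p: "p \<ge> 1" and w: "w \<in> carrier G" and f: "f \<in> lp_space G p"
  shows lp_average_closed: "lp_average G w N f \<in> lp_space G p"
    and lp_norm_average_le: "lp_norm G p (lp_average G w N f) \<le> lp_norm G p f"
proof -
  note * = lp_linear_combination[OF p finite_lessThan[of N], of "\<lambda>l. lp_translate G (w [^] l) f" G "\<lambda>l. 1 / of_nat N"]
  have "(\<Sum>l<N. cmod (1 / of_nat N) * lp_norm G p (lp_translate G (w [^] l) f)) \<le> lp_norm G p f"
    using w f by (simp add: lp_translate_closed norm_divide)
  then show "lp_average G w N f \<in> lp_space G p"
     "lp_norm G p (lp_average G w N f) \<le> lp_norm G p f"
    using * w f by (auto simp: lp_average_def lp_translate_closed)
qed

text \<open>As \<open>w\<close> has infinite order, the \<open>N\<close> translates of the point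
  mass sit at \<open>N\<close> distinct points \<open>w^l k\<close>, each with weight
  \<open>1 / N\<close>. The sum of p-th powers is thus at most \<open>N * N powr (- p)\<close>. This
  spreading of mass is where infinite order is used.\<close>

lemma lp_average_delta:
  assumes p: "p \<ge> 1" and w: "w \<in> carrier G" "infinite_order G w" and k: "k \<in> carrier G" and N: "N > 0"
  shows "lp_average G w N (\<lambda>h. if h = k then 1 else 0) \<in> lp_space G p"
    and "lp_norm G p (lp_average G w N (\<lambda>h. if h = k then 1 else 0)) \<le> real N powr (1 / p - 1)"
proof -
  define u where "u = lp_average G w N (\<lambda>h. if h = k then 1 else 0)"
  define T where "T = (\<lambda>l. w [^] l \<otimes> k) ` {..<N}"
  have inj: "inj (\<lambda>l::nat. w [^] l)"
  proof (rule linorder_injI)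
    fix i j :: nat
    assume "i < j"
    show "w [^] i \<noteq> w [^] j"
    proof
      assume "w [^] i = w [^] j"
      also have "w [^] j = w [^] i \<otimes> w [^] (j - i)"
        using w \<open>i < j\<close> by (simp add: nat_pow_mult)
      finally have "w [^] (j - i) = \<one>"
        using w by simp
      with w(2) \<open>i < j\<close> show False by (auto simp: infinite_order_def)
    qed
  qed
  have out: "u h = 0" if "h \<notin> T" for h
  proof (cases "h \<in> carrier G")
    case True
    have "inv (w [^] l) \<otimes> h \<noteq> k" if "l < N" for l
    proof
      assume "inv (w [^] l) \<otimes> h = k"
      then have "h = w [^] l \<otimes> k"
        using True w k inv_solve_left[of k "w [^] l" h] by auto
      with that \<open>h \<notin> T\<close> show False by (auto simp: T_def)
    qed
    with True show ?thesis by (auto simp: u_def lp_average_def lp_translate_def)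
  qed (simp add: u_def lp_average_def lp_translate_def)
  have ins: "cmod (u h) \<le> 1 / real N" if hT: "h \<in> T" for h
  proof -
    obtain l0 where l0: "l0 < N" "h = w [^] l0 \<otimes> k"
      using hT by (auto simp: T_def)
    have h: "h \<in> carrier G" using l0 w k by simp
    \<comment> \<open>Exactly one summand meets \<open>h\<close>, so the weights cannot pile up at a
      point.\<close>
    have "inv (w [^] l) \<otimes> h = k \<longleftrightarrow> l = l0" for l
    proof
      assume "inv (w [^] l) \<otimes> h = k"
      then have "h = w [^] l \<otimes> k"
        using h w k inv_solve_left[of k "w [^] l" h] by auto
      then have "w [^] l = w [^] l0"
        using l0 w k by simp
      then show "l = l0" using inj by (simp add: inj_def)
    next
      assume "l = l0"
      then show "inv (w [^] l) \<otimes> h = k" using l0 w k by (simp add: m_assoc[symmetric])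
    qed
    then have "u h = (\<Sum>l<N. if l = l0 then 1 / of_nat N else 0)"
      using h unfolding u_def lp_average_def
      by (intro sum.cong) (auto simp: lp_translate_def)
    also have "\<dots> = 1 / of_nat N" using l0 by simp
    finally show ?thesis by (simp add: norm_divide)
  qed
  have "(\<Sum>g\<in>S. cmod (u g) powr p) \<le> (real N powr (1 / p - 1)) powr p"
    if S: "finite S" "S \<subseteq> carrier G" for S
  proof -
    have "(\<Sum>g\<in>S. cmod (u g) powr p) = (\<Sum>g\<in>S \<inter> T. cmod (u g) powr p)"
      using S out by (intro sum.mono_neutral_right) auto
    also have "\<dots> \<le> (\<Sum>g\<in>S \<inter> T. (1 / real N) powr p)"
      using ins p by (intro sum_mono powr_mono2) auto
    also have "\<dots> = real (card (S \<inter> T)) * (1 / real N) powr p" by simp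
    also have "\<dots> \<le> real N * (1 / real N) powr p"
    proof (intro mult_right_mono)
      have "card (S \<inter> T) \<le> card T" by (intro card_mono) (auto simp: T_def)
      also have "\<dots> \<le> N" unfolding T_def using card_image_le[of "{..<N}"] by simp
      finally show "real (card (S \<inter> T)) \<le> real N" by simp
    qed simp
    \<comment> \<open>The exponents agree because \<open>1 - p = (1 / p - 1) * p\<close>.\<close>
    also have "\<dots> = real N powr 1 * real N powr (- p)"
      using N by (simp add: powr_divide powr_minus field_simps)
    also have "\<dots> = (real N powr (1 / p - 1)) powr p"
      using p N powr_mult_base[of "real N" "- p"] by (simp add: powr_powr algebra_simps)
    finally show ?thesis .
  qed
  note * = lp_normI[OF p _ _ this]
  have nc: "u g = 0" if "g \<notin> carrier G" for g
    using that by (simp add: u_def lp_average_def lp_translate_def)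
  show "lp_average G w N (\<lambda>h. if h = k then 1 else 0) \<in> lp_space G p"
    "lp_norm G p (lp_average G w N (\<lambda>h. if h = k then 1 else 0)) \<le> real N powr (1 / p - 1)"
    using *[OF _ nc] unfolding u_def by auto
qed

text \<open>Density of finitely supported functions: \<open>S\<close> is chosen so that its partial
  sum comes within \<open>e powr p\<close> of the total, and any finite sum off \<open>S\<close> is
  then at most \<open>e powr p\<close>.\<close>

lemma lp_finite_approx:
  assumes p: "p \<ge> 1" and f: "f \<in> lp_space G p" and e: "e > 0"
  obtains S where "finite S" "S \<subseteq> carrier G"
    "(\<lambda>g. if g \<in> S then 0 else f g) \<in> lp_space G p"
    "lp_norm G p (\<lambda>g. if g \<in> S then 0 else f g) \<le> e"
proof -
  let ?s = "\<Sum>\<^sub>\<infinity>g\<in>carrier G. cmod (f g) powr p"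
  have sm: "(\<lambda>g. cmod (f g) powr p) summable_on carrier G"
    using f by (simp add: lp_space_def)
  have "\<forall>\<^sub>F S in finite_subsets_at_top (carrier G). ?s - e powr p < (\<Sum>g\<in>S. cmod (f g) powr p)"
    using infsum_tendsto[OF sm] e by (intro order_tendstoD(1)) auto
  then obtain S where S: "finite S" "S \<subseteq> carrier G" and big: "?s - e powr p < (\<Sum>g\<in>S. cmod (f g) powr p)"
    unfolding eventually_finite_subsets_at_top by blast
  have "(\<Sum>g\<in>T. cmod (if g \<in> S then 0 else f g) powr p) \<le> e powr p"
    if T: "finite T" "T \<subseteq> carrier G" for T
  proof -
    have "(\<Sum>g\<in>T. cmod (if g \<in> S then 0 else f g) powr p) = (\<Sum>g\<in>T - S. cmod (f g) powr p)"
      using T by (intro sum.mono_neutral_cong_right) auto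
    moreover have "(\<Sum>g\<in>S. cmod (f g) powr p) + (\<Sum>g\<in>T - S. cmod (f g) powr p)
        = (\<Sum>g\<in>S \<union> (T - S). cmod (f g) powr p)"
      using S T by (intro sum.union_disjoint[symmetric]) auto
    moreover have "\<dots> \<le> ?s"
      using S T by (intro finite_sum_le_infsum[OF sm]) auto
    ultimately show ?thesis using big by linarith
  qed
  from lp_normI[where G = G, OF p _ _ this]
  have "(\<lambda>g. if g \<in> S then 0 else f g) \<in> lp_space G p"
    "lp_norm G p (\<lambda>g. if g \<in> S then 0 else f g) \<le> e"
    using e lp_spaceD[OF f] by auto
  then show ?thesis using that[OF S] by blast
qed

text \<open>A density argument: \<open>f\<close> is a finite combination of point masses plus a
  remainder of norm at most \<open>e / 2\<close>. The averages contract, so the remainder stays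
  small for every \<open>N\<close>, while the finite part is bounded by
  \<open>C * N powr (1 / p - 1)\<close>.\<close>

lemma lp_average_tendsto_0:
  assumes p: "p > 1" and w: "w \<in> carrier G" "infinite_order G w" and f: "f \<in> lp_space G p"
  shows "(\<lambda>N. lp_norm G p (lp_average G w N f)) \<longlonglongrightarrow> 0"
proof (rule LIMSEQ_I)
  fix e :: real
  assume e: "e > 0"
  have p1: "p \<ge> 1" using p by simp
  obtain S where S: "finite S" "S \<subseteq> carrier G"
    and r: "(\<lambda>g. if g \<in> S then 0 else f g) \<in> lp_space G p"
      "lp_norm G p (\<lambda>g. if g \<in> S then 0 else f g) \<le> e / 2"
    using lp_finite_approx[OF p1 f, of "e / 2"] e by auto
  let ?r = "\<lambda>g. if g \<in> S then 0 else f g"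
  let ?\<delta> = "\<lambda>k h. if h = k then 1 else 0 :: complex"
  define C where "C = (\<Sum>k\<in>S. cmod (f k))"
  \<comment> \<open>The exponent \<open>1 / p - 1\<close> is negative because
    \<open>p > 1\<close>.\<close>
  have "(\<lambda>N. C * real N powr (1 / p - 1)) \<longlonglongrightarrow> C * 0"
    by (intro tendsto_mult tendsto_const tendsto_neg_powr filterlim_real_sequentially)
      (use p in \<open>auto simp: field_simps\<close>)
  then have "\<forall>\<^sub>F N in sequentially. C * real N powr (1 / p - 1) < e / 2"
    using e by (intro order_tendstoD(2)) auto
  then obtain N0 where N0: "\<And>N. N \<ge> N0 \<Longrightarrow> C * real N powr (1 / p - 1) < e / 2"
    unfolding eventually_sequentially by blast
  show "\<exists>N0. \<forall>N\<ge>N0. norm (lp_norm G p (lp_average G w N f) - 0) < e"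
  proof (intro exI allI impI)
    fix N assume N: "N \<ge> max N0 1"
    let ?A = "lp_average G w N"
    have split: "f = (\<lambda>g. (\<Sum>k\<in>S. f k * ?\<delta> k g) + ?r g)"
      using S(1) by (auto simp: if_distrib cong: if_cong)
    have "?A f = (\<lambda>h. (\<Sum>k\<in>S. f k * ?A (?\<delta> k) h) + ?A ?r h)"
    proof -
      have "?A f = ?A (\<lambda>g. (\<Sum>k\<in>S. f k * ?\<delta> k g) + ?r g)"
        using split by metis
      also have "\<dots> = (\<lambda>h. ?A (\<lambda>g. \<Sum>k\<in>S. f k * ?\<delta> k g) h + ?A ?r h)"
        unfolding lp_average_def lp_translate_add by (simp add: sum.distrib distrib_left)
      also have "?A (\<lambda>g. \<Sum>k\<in>S. f k * ?\<delta> k g) = (\<lambda>h. \<Sum>k\<in>S. f k * ?A (?\<delta> k) h)"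
        unfolding lp_average_def lp_translate_linear_combination sum_distrib_left
        by (subst sum.swap) (simp add: mult_ac)
      finally show ?thesis .
    qed
    moreover have d: "?A (?\<delta> k) \<in> lp_space G p" "lp_norm G p (?A (?\<delta> k)) \<le> real N powr (1 / p - 1)"
      if "k \<in> S" for k
      using lp_average_delta[OF p1 w, of k N] S that N by auto
    moreover have "(\<lambda>h. \<Sum>k\<in>S. f k * ?A (?\<delta> k) h) \<in> lp_space G p \<and>
      lp_norm G p (\<lambda>h. \<Sum>k\<in>S. f k * ?A (?\<delta> k) h) \<le> (\<Sum>k\<in>S. cmod (f k) * lp_norm G p (?A (?\<delta> k)))"
      using lp_linear_combination[OF p1 S(1) d(1)] by simp
    moreover have "(\<Sum>k\<in>S. cmod (f k) * lp_norm G p (?A (?\<delta> k))) \<le> C * real N powr (1 / p - 1)"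
      unfolding C_def sum_distrib_right using d by (intro sum_mono mult_left_mono) auto
    moreover have "?A ?r \<in> lp_space G p" "lp_norm G p (?A ?r) \<le> e / 2"
      using lp_average[OF p1 w(1) r(1), of N] r(2) by auto
    ultimately have "lp_norm G p (?A f) \<le> C * real N powr (1 / p - 1) + e / 2"
      using lp_norm_triangle[OF p1, of "\<lambda>h. \<Sum>k\<in>S. f k * ?A (?\<delta> k) h" G "?A ?r"] by auto
    also have "\<dots> < e" using N0[of N] N by simp
    finally show "norm (lp_norm G p (?A f) - 0) < e" by simp
  qed
qed

end

section \<open>The mean ergodic theorem for a central element\<close>

lemma lp_module_simps [simp]:
  "carrier (lp_module G p) = lp_space G p"
  "\<zero>\<^bsub>lp_module G p\<^esub> = (\<lambda>g. 0)"
  "f \<oplus>\<^bsub>lp_module G p\<^esub> h = (\<lambda>g. f g + h g)"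
  by (auto simp: lp_module_def)

text \<open>The support of a group ring element may shrink by cancellation: that of
  \<open>w - 1\<close> is empty when \<open>w\<close> is the identity. Summing over a fixed finite
  superset keeps the formula uniform.\<close>

lemma lp_module_smult_superset:
  assumes "finite S" "Poly_Mapping.keys a \<subseteq> S"
  shows "a \<odot>\<^bsub>lp_module G p\<^esub> f =
    (\<lambda>h. \<Sum>g\<in>S. of_int (Poly_Mapping.lookup a g) * lp_translate G g f h)"
  unfolding lp_module_smult using assms
  by (intro ext sum.mono_neutral_left) (auto simp: in_keys_iff)

lemma lp_module_smult_add:
  "a \<odot>\<^bsub>lp_module G p\<^esub> (\<lambda>g. f g + h g) =
    (\<lambda>g. (a \<odot>\<^bsub>lp_module G p\<^esub> f) g + (a \<odot>\<^bsub>lp_module G p\<^esub> h) g)"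
  unfolding lp_module_smult lp_translate_add by (simp add: distrib_left sum.distrib)

lemma (in group) lp_module_smult_closed:
  assumes "p \<ge> 1" "Poly_Mapping.keys a \<subseteq> carrier G" "f \<in> lp_space G p"
  shows "a \<odot>\<^bsub>lp_module G p\<^esub> f \<in> lp_space G p"
  unfolding lp_module_smult
  by (rule conjunct1[OF lp_linear_combination[OF assms(1) finite_keys]])
    (use assms lp_translate_closed(1) in auto)

lemma group_ring_simps [simp]:
  "carrier (group_ring G) = {a. Poly_Mapping.keys a \<subseteq> carrier G}"
  "\<zero>\<^bsub>group_ring G\<^esub> = 0"
  "\<one>\<^bsub>group_ring G\<^esub> = frag_of \<one>\<^bsub>G\<^esub>"
  "a \<oplus>\<^bsub>group_ring G\<^esub> b = a + b"
  "a \<otimes>\<^bsub>group_ring G\<^esub> b = frag_extend (\<lambda>g. frag_extend (\<lambda>h. frag_of (g \<otimes>\<^bsub>G\<^esub> h)) b) a"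
  by (auto simp: group_ring_def)

section \<open>The central element \<open>z - 1\<close> and its action on
  \<open>l^p(G)\<close>\<close>

context group begin

lemma keys_group_ring_diff:
  assumes "z \<in> carrier G"
  shows "Poly_Mapping.keys (frag_of z - frag_of \<one>) \<subseteq> carrier G"
  using assms keys_diff[of "frag_of z" "frag_of \<one>"] by auto

text \<open>Both sides are additive in \<open>a\<close>, so the comparison takes place on basis
  elements, where it reads \<open>z h = h z\<close>. It makes multiplication by \<open>z - 1\<close>
  linear over the noncommutative ring.\<close>

lemma group_ring_central:
  assumes z: "z \<in> group_center G" and a: "Poly_Mapping.keys a \<subseteq> carrier G"
  shows "(frag_of z - frag_of \<one>) \<otimes>\<^bsub>group_ring G\<^esub> a = a \<otimes>\<^bsub>group_ring G\<^esub> (frag_of z - frag_of \<one>)"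
proof -
  have sub: "frag_extend f a - frag_extend f' a = frag_extend (\<lambda>h. f h - f' h) a"
    for f f' :: "'a \<Rightarrow> 'a \<Rightarrow>\<^sub>0 int"
  proof -
    have "frag_cmul k (x - y) = frag_cmul k x - frag_cmul k y" for k and x y :: "'a \<Rightarrow>\<^sub>0 int"
      by (rule poly_mapping_eqI) (simp add: lookup_minus algebra_simps)
    then show ?thesis by (simp add: frag_extend_def sum_subtractf)
  qed
  have "(frag_of z - frag_of \<one>) \<otimes>\<^bsub>group_ring G\<^esub> a =
      frag_extend (\<lambda>h. frag_of (z \<otimes> h) - frag_of (\<one> \<otimes> h)) a"
    by (simp add: frag_extend_diff sub)
  also have "\<dots> = frag_extend (\<lambda>h. frag_of (h \<otimes> z) - frag_of (h \<otimes> \<one>)) a"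
    using a z by (intro frag_extend_eq) (auto simp: group_center_def subset_iff)
  also have "\<dots> = a \<otimes>\<^bsub>group_ring G\<^esub> (frag_of z - frag_of \<one>)"
    by (simp add: frag_extend_diff)
  finally show ?thesis .
qed

text \<open>This is the element by which \<open>z - 1\<close> is exchanged when it crosses the
  tensor sign.\<close>

lemma group_ring_star_diff:
  "group_ring_star G (frag_of z - frag_of \<one>) = frag_of (inv z) - frag_of \<one>"
  by (simp add: group_ring_star_def frag_extend_diff)

lemma lp_module_smult_diff:
  assumes "f \<in> lp_space G p"
  shows "(frag_of w - frag_of \<one>) \<odot>\<^bsub>lp_module G p\<^esub> f = (\<lambda>h. lp_translate G w f h - f h)"
proof -
  have "(frag_of w - frag_of \<one>) \<odot>\<^bsub>lp_module G p\<^esub> f = (\<lambda>h. \<Sum>g\<in>{w, \<one>}.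
      of_int (Poly_Mapping.lookup (frag_of w - frag_of \<one>) g) * lp_translate G g f h)"
    using keys_diff[of "frag_of w" "frag_of \<one>"] by (intro lp_module_smult_superset) auto
  then show ?thesis
    using lp_translate_one[OF assms] by (cases "w = \<one>") (auto simp: lookup_minus)
qed

lemma group_center_pow:
  assumes "w \<in> group_center G"
  shows "w [^] (l::nat) \<in> group_center G"
proof (induction l)
  case (Suc l)
  have "w [^] l \<otimes> w \<otimes> g = g \<otimes> (w [^] l \<otimes> w)" if g: "g \<in> carrier G" for g
  proof -
    have w: "w \<in> carrier G" "w \<otimes> g = g \<otimes> w" and l: "w [^] l \<otimes> g = g \<otimes> w [^] l"
      using assms Suc g by (auto simp: group_center_def)
    have "w [^] l \<otimes> w \<otimes> g = w [^] l \<otimes> g \<otimes> w"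
      using w g by (simp add: m_assoc)
    also have "\<dots> = g \<otimes> (w [^] l \<otimes> w)"
      using w g by (simp only: l) (simp add: m_assoc)
    finally show ?thesis .
  qed
  with assms show ?case by (simp add: group_center_def)
qed (simp add: group_center_def)

lemma group_center_inv:
  assumes "w \<in> group_center G"
  shows "inv w \<in> group_center G"
proof -
  have w: "w \<in> carrier G" using assms by (simp add: group_center_def)
  have "inv w \<otimes> g = g \<otimes> inv w" if g: "g \<in> carrier G" for g
  proof -
    have "w \<otimes> (g \<otimes> inv w) = (w \<otimes> g) \<otimes> inv w"
      using w g by (simp add: m_assoc)
    also have "w \<otimes> g = g \<otimes> w"
      using assms g by (simp add: group_center_def)
    also have "g \<otimes> w \<otimes> inv w = g"
      using w g by (simp add: m_assoc)
    finally show ?thesis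
      using w g inv_solve_left[of "g \<otimes> inv w" w g] by auto
  qed
  with w show ?thesis by (simp add: group_center_def)
qed

lemma infinite_order_inv:
  assumes "w \<in> carrier G" "infinite_order G w"
  shows "infinite_order G (inv w)"
  using assms by (simp add: infinite_order_def nat_pow_inv)

text \<open>Translation by a central element commutes with every translation, so any combination of
  such translations is equivariant. The coefficients may be arbitrary complex numbers, which the
  operators \<open>Q N\<close> require.\<close>

lemma lp_translate_combination_mod_hom:
  assumes p: "p \<ge> 1" and w: "\<And>l. l \<in> I \<Longrightarrow> w l \<in> group_center G" and "finite I"
  shows "(\<lambda>f h. \<Sum>l\<in>I. c l * lp_translate G (w l) f h) \<in> mod_hom (group_ring G) (lp_module G p) (lp_module G p)"
proof -
  have comm: "lp_translate G (w l) (lp_translate G g f) = lp_translate G g (lp_translate G (w l) f)"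
    if "l \<in> I" "g \<in> carrier G" for l g and f :: "'a \<Rightarrow> complex"
    using w[OF that(1)] that(2) by (simp add: lp_translate_mult group_center_def)
  have smult: "(\<Sum>l\<in>I. c l * lp_translate G (w l) (a \<odot>\<^bsub>lp_module G p\<^esub> f) h) =
      (a \<odot>\<^bsub>lp_module G p\<^esub> (\<lambda>h. \<Sum>l\<in>I. c l * lp_translate G (w l) f h)) h"
    if "Poly_Mapping.keys a \<subseteq> carrier G" for a f h
  proof -
    have "(\<Sum>l\<in>I. c l * lp_translate G (w l) (a \<odot>\<^bsub>lp_module G p\<^esub> f) h) =
      (\<Sum>l\<in>I. \<Sum>g\<in>Poly_Mapping.keys a.
        of_int (Poly_Mapping.lookup a g) * (c l * lp_translate G g (lp_translate G (w l) f) h))"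
      unfolding lp_module_smult lp_translate_linear_combination sum_distrib_left
      using that by (intro sum.cong) (auto simp: comm subset_iff)
    also have "\<dots> = (a \<odot>\<^bsub>lp_module G p\<^esub> (\<lambda>h. \<Sum>l\<in>I. c l * lp_translate G (w l) f h)) h"
      unfolding lp_module_smult lp_translate_linear_combination sum_distrib_left
      by (rule sum.swap)
    finally show ?thesis .
  qed
  have closed: "(\<lambda>h. \<Sum>l\<in>I. c l * lp_translate G (w l) f h) \<in> lp_space G p" if "f \<in> lp_space G p" for f
    using lp_linear_combination[where G = G and f = "\<lambda>l. lp_translate G (w l) f", OF p \<open>finite I\<close>]
      lp_translate_closed(1)[OF that] w by (auto simp: group_center_def)
  show ?thesis
    unfolding mod_hom_def using closed smult
    by (auto simp: lp_translate_add distrib_left sum.distrib)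
qed

text \<open>Summation by parts: consecutive weights differ by one, so \<open>u l\<close> with
  \<open>0 < l < N\<close> receives coefficient -1, and \<open>u 0\<close> receives
  \<open>N - 1\<close>. The last weight is 0, so \<open>u N\<close> drops out.\<close>

lemma ergodic_telescope:
  fixes u :: "nat \<Rightarrow> 'r::comm_ring_1"
  shows "(\<Sum>l<N. of_nat (N - 1 - l) * (u l - u (Suc l))) = of_nat N * u 0 - (\<Sum>l<N. u l)"
proof (induction N)
  case (Suc N)
  \<comment> \<open>Passing from \<open>N\<close> to \<open>Suc N\<close> raises every old weight by
    one and adds a term of weight 0, so the increment is the plain telescoping sum.\<close>
  have "of_nat (Suc N - 1 - l) * (u l - u (Suc l)) =
      of_nat (N - 1 - l) * (u l - u (Suc l)) + (u l - u (Suc l))" if "l < N" for l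
  proof -
    have "Suc N - 1 - l = Suc (N - 1 - l)" using that by simp
    then show ?thesis by (simp only: of_nat_Suc distrib_right mult_1 add.commute)
  qed
  then have "(\<Sum>l<Suc N. of_nat (Suc N - 1 - l) * (u l - u (Suc l)))
      = (\<Sum>l<N. of_nat (N - 1 - l) * (u l - u (Suc l)) + (u l - u (Suc l)))"
    unfolding sum.lessThan_Suc by (simp del: diff_Suc_1)
  then show ?case
    using sum_lessThan_telescope'[of u N] Suc by (simp add: sum.distrib) (simp add: algebra_simps)
qed simp

end

context group begin
text \<open>The form matters: density of the range of \<open>w - 1\<close> alone would give
  unrelated approximants for each \<open>f\<close>. Here they are the values of equivariant
  operators chosen independently of \<open>f\<close>, so they can be composed with cochains and
  applied to the second factor of a tensor product.\<close>

lemma lp_mean_ergodic: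
  assumes p: "p > 1" and w: "w \<in> group_center G" "infinite_order G w"
  obtains Q :: "nat \<Rightarrow> ('a \<Rightarrow> complex) \<Rightarrow> ('a \<Rightarrow> complex)" where
    "\<And>N. Q N \<in> mod_hom (group_ring G) (lp_module G p) (lp_module G p)"
    "\<And>f. f \<in> lp_space G p \<Longrightarrow>
      limitin (lp_topology G p) (\<lambda>N. (frag_of w - frag_of \<one>) \<odot>\<^bsub>lp_module G p\<^esub> Q N f) f sequentially"
proof
  define Q where "Q = (\<lambda>N f h. \<Sum>l<N. - (of_nat (N - 1 - l) / of_nat N) * lp_translate G (w [^] l) f h)"
  have p1: "p \<ge> 1" using p by simp
  have wc: "w \<in> carrier G" using w by (simp add: group_center_def)
  show hom: "Q N \<in> mod_hom (group_ring G) (lp_module G p) (lp_module G p)" for N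
    unfolding Q_def by (rule lp_translate_combination_mod_hom[OF p1]) (auto intro: group_center_pow w)
  fix f assume f: "f \<in> lp_space G p"
  have Qf: "Q N f \<in> lp_space G p" for N using hom[of N] f by (auto simp: mod_hom_def)
  \<comment> \<open>For \<open>N = 0\<close> both \<open>Q N f\<close> and the average are empty
    sums and the identity would say \<open>f = 0\<close>; the limit ignores this index.\<close>
  have eq: "((frag_of w - frag_of \<one>) \<odot>\<^bsub>lp_module G p\<^esub> Q N f) h - f h = - lp_average G w N f h"
    if N: "N > 0" for N h
  proof -
    let ?u = "\<lambda>l. lp_translate G (w [^] l) f h"
    have neg: "- (c / n) * (a - b) = c * (b - a) / n" for a b c n :: complex
      by (simp add: algebra_simps diff_divide_distrib)
    have "((frag_of w - frag_of \<one>) \<odot>\<^bsub>lp_module G p\<^esub> Q N f) h =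
      (\<Sum>l<N. - (of_nat (N - 1 - l) / of_nat N) * (lp_translate G w (lp_translate G (w [^] l) f) h - ?u l))"
      unfolding lp_module_smult_diff[OF Qf]
      unfolding Q_def lp_translate_linear_combination
      by (simp only: sum_subtractf right_diff_distrib)
    also have "\<dots> = (\<Sum>l<N. of_nat (N - 1 - l) * (?u l - ?u (Suc l))) / of_nat N"
      unfolding sum_divide_distrib
    proof (intro sum.cong refl)
      fix l
      have "lp_translate G w (lp_translate G (w [^] l) f) = lp_translate G (w [^] Suc l) f"
        using wc by (simp only: lp_translate_mult nat_pow_closed nat_pow_Suc2)
      then show "- (of_nat (N - 1 - l) / of_nat N) * (lp_translate G w (lp_translate G (w [^] l) f) h - ?u l) =
        of_nat (N - 1 - l) * (?u l - ?u (Suc l)) / of_nat N"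
        by (simp only: neg)
    qed
    also have "\<dots> = (of_nat N * f h - (\<Sum>l<N. ?u l)) / of_nat N"
      using ergodic_telescope[of N ?u] by (simp only: nat_pow_0 lp_translate_one[OF f])
    finally show ?thesis
      using N by (simp add: lp_average_def sum_divide_distrib diff_divide_distrib)
  qed
  have norm_eq: "lp_norm G p (\<lambda>h. ((frag_of w - frag_of \<one>) \<odot>\<^bsub>lp_module G p\<^esub> Q N f) h - f h)
      = lp_norm G p (lp_average G w N f)" if "N > 0" for N
    using eq[OF that] by (simp add: lp_norm_def)
  show "limitin (lp_topology G p) (\<lambda>N. (frag_of w - frag_of \<one>) \<odot>\<^bsub>lp_module G p\<^esub> Q N f) f sequentially"
    unfolding limitin_lp_topology[OF p1]
  proof (intro conjI f allI impI)
    fix e :: real assume "e > 0"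
    then have "\<forall>\<^sub>F N in sequentially. lp_norm G p (lp_average G w N f) < e"
      using lp_average_tendsto_0[OF p wc w(2) f] order_tendstoD(2) by blast
    with eventually_gt_at_top[of 0] show "\<forall>\<^sub>F N in sequentially.
      (frag_of w - frag_of \<one>) \<odot>\<^bsub>lp_module G p\<^esub> Q N f \<in> lp_space G p \<and>
      lp_norm G p (\<lambda>h. ((frag_of w - frag_of \<one>) \<odot>\<^bsub>lp_module G p\<^esub> Q N f) h - f h) < e"
    proof eventually_elim
      case (elim N)
      with norm_eq lp_module_smult_closed[OF p1 keys_group_ring_diff[OF wc] Qf] show ?case
        by simp
    qed
  qed
qed

end

section \<open>Projective modules and homotopies\<close>

lemma mod_homD:
  assumes "f \<in> mod_hom R M N"
  shows mod_hom_closed: "\<And>x. x \<in> carrier M \<Longrightarrow> f x \<in> carrier N"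
    and mod_hom_add: "\<And>x y. x \<in> carrier M \<Longrightarrow> y \<in> carrier M \<Longrightarrow> f (x \<oplus>\<^bsub>M\<^esub> y) = f x \<oplus>\<^bsub>N\<^esub> f y"
    and mod_hom_smult: "\<And>a x. a \<in> carrier R \<Longrightarrow> x \<in> carrier M \<Longrightarrow> f (a \<odot>\<^bsub>M\<^esub> x) = a \<odot>\<^bsub>N\<^esub> f x"
  using assms by (auto simp: mod_hom_def)

lemma mod_hom_compose:
  assumes "f \<in> mod_hom R M N" "g \<in> mod_hom R N P"
  shows "(\<lambda>x. g (f x)) \<in> mod_hom R M P"
  using assms by (auto simp: mod_hom_def Pi_iff)

context left_module begin

lemma smult_zero_left: "x \<in> carrier M \<Longrightarrow> \<zero>\<^bsub>R\<^esub> \<odot>\<^bsub>M\<^esub> x = \<zero>\<^bsub>M\<^esub>"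
  using smult_l_distr[of "\<zero>\<^bsub>R\<^esub>" "\<zero>\<^bsub>R\<^esub>" x] smult_closed[of "\<zero>\<^bsub>R\<^esub>" x]
  by (simp add: M.add.l_cancel_one)

lemma smult_zero_right: "a \<in> carrier R \<Longrightarrow> a \<odot>\<^bsub>M\<^esub> \<zero>\<^bsub>M\<^esub> = \<zero>\<^bsub>M\<^esub>"
  using smult_r_distr[of a "\<zero>\<^bsub>M\<^esub>" "\<zero>\<^bsub>M\<^esub>"] smult_closed[of a "\<zero>\<^bsub>M\<^esub>"]
  by (simp add: M.add.l_cancel_one)

lemma smult_finsum:
  assumes "finite A" "a \<in> carrier R" "f \<in> A \<rightarrow> carrier M"
  shows "a \<odot>\<^bsub>M\<^esub> (\<Oplus>\<^bsub>M\<^esub>i\<in>A. f i) = (\<Oplus>\<^bsub>M\<^esub>i\<in>A. a \<odot>\<^bsub>M\<^esub> f i)"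
  using assms
proof (induction A rule: finite_induct)
  case (insert i A)
  have f: "f \<in> A \<rightarrow> carrier M" and fi: "f i \<in> carrier M"
    using insert.prems(2) by (auto simp: Pi_iff)
  have af: "(\<lambda>i. a \<odot>\<^bsub>M\<^esub> f i) \<in> A \<rightarrow> carrier M"
    using f smult_closed[OF insert.prems(1)] by (auto simp: Pi_iff)
  have "a \<odot>\<^bsub>M\<^esub> (\<Oplus>\<^bsub>M\<^esub>i\<in>insert i A. f i) = a \<odot>\<^bsub>M\<^esub> f i \<oplus>\<^bsub>M\<^esub> a \<odot>\<^bsub>M\<^esub> (\<Oplus>\<^bsub>M\<^esub>i\<in>A. f i)"
    unfolding M.finsum_insert[OF insert.hyps f fi]
    by (rule smult_r_distr[OF insert.prems(1) fi M.finsum_closed[OF f]])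
  then show ?case
    using M.finsum_insert[OF insert.hyps af smult_closed[OF insert.prems(1) fi]] insert.IH[OF insert.prems(1) f]
    by simp
qed (simp add: smult_zero_right)

lemma mod_hom_zero:
  assumes "f \<in> mod_hom R M N" "left_module R N"
  shows "f \<zero>\<^bsub>M\<^esub> = \<zero>\<^bsub>N\<^esub>"
proof -
  interpret N: left_module R N by fact
  have "f \<zero>\<^bsub>M\<^esub> \<in> carrier N" using mod_hom_closed[OF assms(1)] by simp
  then show ?thesis
    using mod_hom_smult[OF assms(1) R.zero_closed M.zero_closed]
    by (simp only: smult_zero_right[OF R.zero_closed] N.smult_zero_left)
qed

lemma mod_hom_finsum:
  assumes h: "h \<in> mod_hom R M N" and N: "left_module R N" and "finite A" "f \<in> A \<rightarrow> carrier M"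
  shows "h (\<Oplus>\<^bsub>M\<^esub>i\<in>A. f i) = (\<Oplus>\<^bsub>N\<^esub>i\<in>A. h (f i))"
  using assms(3,4)
proof (induction A rule: finite_induct)
  case empty
  interpret N: left_module R N by fact
  show ?case using mod_hom_zero[OF h N] by simp
next
  case (insert i A)
  interpret N: left_module R N by fact
  have f: "f \<in> A \<rightarrow> carrier M" and fi: "f i \<in> carrier M"
    using insert.prems by (auto simp: Pi_iff)
  have hf: "(\<lambda>i. h (f i)) \<in> A \<rightarrow> carrier N"
    using f mod_hom_closed[OF h] by (auto simp: Pi_iff)
  show ?case
    unfolding M.finsum_insert[OF insert.hyps f fi] mod_hom_add[OF h fi M.finsum_closed[OF f]]
    by (simp add: N.M.finsum_insert[OF insert.hyps hf mod_hom_closed[OF h fi]] insert.IH[OF f])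
qed

end

section \<open>The universal property of free modules, and lifting from projective modules\<close>

lemma free_left_module_simps [simp]:
  "\<zero>\<^bsub>free_left_module R S\<^esub> = (\<lambda>x. \<zero>\<^bsub>R\<^esub>)"
  "f \<oplus>\<^bsub>free_left_module R S\<^esub> h = (\<lambda>x. f x \<oplus>\<^bsub>R\<^esub> h x)"
  "a \<odot>\<^bsub>free_left_module R S\<^esub> f = (\<lambda>x. a \<otimes>\<^bsub>R\<^esub> f x)"
  by (auto simp: free_left_module_def)

lemma free_left_module_carrier_iff:
  "f \<in> carrier (free_left_module R S) \<longleftrightarrow>
    (\<forall>x. f x \<in> carrier R) \<and> finite {x. f x \<noteq> \<zero>\<^bsub>R\<^esub>} \<and> {x. f x \<noteq> \<zero>\<^bsub>R\<^esub>} \<subseteq> S"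
  by (simp add: free_left_module_def)

definition free_basis :: "('r, 'x) ring_scheme \<Rightarrow> 's \<Rightarrow> 's \<Rightarrow> 'r"
  where "free_basis R b = (\<lambda>x. if x = b then \<one>\<^bsub>R\<^esub> else \<zero>\<^bsub>R\<^esub>)"

definition free_extend :: "('r, 'x) ring_scheme \<Rightarrow> ('r, 'a, 'y) module_scheme \<Rightarrow> ('s \<Rightarrow> 'a) \<Rightarrow> ('s \<Rightarrow> 'r) \<Rightarrow> 'a"
  where "free_extend R M m f = (\<Oplus>\<^bsub>M\<^esub>b\<in>{b. f b \<noteq> \<zero>\<^bsub>R\<^esub>}. f b \<odot>\<^bsub>M\<^esub> m b)"

lemma (in ring) free_basis_closed:
  "b \<in> S \<Longrightarrow> free_basis R b \<in> carrier (free_left_module R S)"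
  by (auto simp: free_left_module_carrier_iff free_basis_def intro: finite_subset[of _ "{b}"])

context left_module begin

text \<open>Terms off the support contribute zero. The supports of \<open>a f\<close> and
  \<open>f + h\<close> can be smaller than those of their ingredients, so linearity of the extension
  is checked over a common finite index set.\<close>

lemma free_extend_superset:
  assumes m: "m \<in> S \<rightarrow> carrier M" and f: "\<And>x. f x \<in> carrier R"
    and A: "finite A" "{x. f x \<noteq> \<zero>\<^bsub>R\<^esub>} \<subseteq> A" "A \<subseteq> S"
  shows "free_extend R M m f = (\<Oplus>\<^bsub>M\<^esub>b\<in>A. f b \<odot>\<^bsub>M\<^esub> m b)"
  unfolding free_extend_def
proof (rule M.add.finprod_mono_neutral_cong_left[OF A(1,2)])
  show "f i \<odot>\<^bsub>M\<^esub> m i = \<zero>\<^bsub>M\<^esub>" if "i \<in> A - {b. f b \<noteq> \<zero>\<^bsub>R\<^esub>}" for i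
  proof -
    have "m i \<in> carrier M" "f i = \<zero>\<^bsub>R\<^esub>" using that m A by auto
    then show ?thesis by (simp add: smult_zero_left)
  qed
  show "(\<lambda>b. f b \<odot>\<^bsub>M\<^esub> m b) \<in> A \<rightarrow> carrier M"
    using m f A by (auto intro!: smult_closed)
qed simp

lemma free_extend_mod_hom:
  assumes m: "m \<in> S \<rightarrow> carrier M"
  shows "free_extend R M m \<in> mod_hom R (free_left_module R S) M"
  unfolding mod_hom_def
proof (intro CollectI conjI ballI funcsetI)
  fix f assume f: "f \<in> carrier (free_left_module R S)"
  let ?A = "{x. f x \<noteq> \<zero>\<^bsub>R\<^esub>}"
  have fc: "f x \<in> carrier R" and fA: "finite ?A" "?A \<subseteq> S" for x
    using f by (auto simp: free_left_module_carrier_iff)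
  have fin: "(\<lambda>b. f b \<odot>\<^bsub>M\<^esub> m b) \<in> A \<rightarrow> carrier M" if "A \<subseteq> S" for A
    using that m fc by (auto intro!: smult_closed)
  show "free_extend R M m f \<in> carrier M"
    unfolding free_extend_def by (rule M.finsum_closed[OF fin[OF fA(2)]])
  fix a assume a: "a \<in> carrier R"
  have "free_extend R M m (\<lambda>x. a \<otimes>\<^bsub>R\<^esub> f x) = (\<Oplus>\<^bsub>M\<^esub>b\<in>?A. (a \<otimes>\<^bsub>R\<^esub> f b) \<odot>\<^bsub>M\<^esub> m b)"
    using a fA by (intro free_extend_superset[OF m]) (auto simp: fc)
  also have "\<dots> = (\<Oplus>\<^bsub>M\<^esub>b\<in>?A. a \<odot>\<^bsub>M\<^esub> (f b \<odot>\<^bsub>M\<^esub> m b))"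
  proof (rule M.finsum_cong')
    show "(\<lambda>b. a \<odot>\<^bsub>M\<^esub> (f b \<odot>\<^bsub>M\<^esub> m b)) \<in> ?A \<rightarrow> carrier M"
      using fin[OF fA(2)] smult_closed[OF a] by (simp add: Pi_iff)
    fix i assume "i \<in> ?A"
    then have "m i \<in> carrier M" using m fA by blast
    then show "(a \<otimes>\<^bsub>R\<^esub> f i) \<odot>\<^bsub>M\<^esub> m i = a \<odot>\<^bsub>M\<^esub> (f i \<odot>\<^bsub>M\<^esub> m i)"
      by (rule smult_assoc1[OF a fc])
  qed simp
  also have "\<dots> = a \<odot>\<^bsub>M\<^esub> free_extend R M m f"
    unfolding free_extend_def by (rule smult_finsum[OF fA(1) a fin[OF fA(2)], symmetric])
  finally show "free_extend R M m (a \<odot>\<^bsub>free_left_module R S\<^esub> f) = a \<odot>\<^bsub>M\<^esub> free_extend R M m f"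
    by simp
next
  fix f h assume f: "f \<in> carrier (free_left_module R S)" and h: "h \<in> carrier (free_left_module R S)"
  let ?A = "{x. f x \<noteq> \<zero>\<^bsub>R\<^esub>} \<union> {x. h x \<noteq> \<zero>\<^bsub>R\<^esub>}"
  have c: "f x \<in> carrier R" "h x \<in> carrier R" and A: "finite ?A" "?A \<subseteq> S" for x
    using f h by (auto simp: free_left_module_carrier_iff)
  have mA: "m b \<in> carrier M" if "b \<in> ?A" for b using A(2) m that by blast
  have fin: "(\<lambda>b. f b \<odot>\<^bsub>M\<^esub> m b) \<in> ?A \<rightarrow> carrier M" "(\<lambda>b. h b \<odot>\<^bsub>M\<^esub> m b) \<in> ?A \<rightarrow> carrier M"
    using smult_closed[OF c(1) mA] smult_closed[OF c(2) mA] by blast+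
  have "free_extend R M m (\<lambda>x. f x \<oplus>\<^bsub>R\<^esub> h x) = (\<Oplus>\<^bsub>M\<^esub>b\<in>?A. (f b \<oplus>\<^bsub>R\<^esub> h b) \<odot>\<^bsub>M\<^esub> m b)"
    using A by (intro free_extend_superset[OF m]) (auto simp: c)
  also have "\<dots> = (\<Oplus>\<^bsub>M\<^esub>b\<in>?A. f b \<odot>\<^bsub>M\<^esub> m b \<oplus>\<^bsub>M\<^esub> h b \<odot>\<^bsub>M\<^esub> m b)"
  proof (rule M.finsum_cong')
    show "(\<lambda>b. f b \<odot>\<^bsub>M\<^esub> m b \<oplus>\<^bsub>M\<^esub> h b \<odot>\<^bsub>M\<^esub> m b) \<in> ?A \<rightarrow> carrier M"
      using fin by (auto simp: Pi_iff)
  qed (simp_all only: smult_l_distr[OF c mA])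
  also have "\<dots> = (\<Oplus>\<^bsub>M\<^esub>b\<in>?A. f b \<odot>\<^bsub>M\<^esub> m b) \<oplus>\<^bsub>M\<^esub> (\<Oplus>\<^bsub>M\<^esub>b\<in>?A. h b \<odot>\<^bsub>M\<^esub> m b)"
    by (rule M.finsum_addf[OF fin])
  also have "(\<Oplus>\<^bsub>M\<^esub>b\<in>?A. f b \<odot>\<^bsub>M\<^esub> m b) = free_extend R M m f"
    using A by (intro free_extend_superset[OF m, symmetric]) (auto simp: c)
  also have "(\<Oplus>\<^bsub>M\<^esub>b\<in>?A. h b \<odot>\<^bsub>M\<^esub> m b) = free_extend R M m h"
    using A by (intro free_extend_superset[OF m, symmetric]) (auto simp: c)
  finally show "free_extend R M m (f \<oplus>\<^bsub>free_left_module R S\<^esub> h) =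
      free_extend R M m f \<oplus>\<^bsub>M\<^esub> free_extend R M m h"
    by simp
qed

text \<open>The uniqueness half of the universal property: a homomorphism is determined by its
  values on the basis. The induction removes one coordinate at a time from a finite set containing
  the support.\<close>

lemma mod_hom_free_expansion:
  assumes u: "u \<in> mod_hom R (free_left_module R S) M"
    and f: "f \<in> carrier (free_left_module R S)"
  shows "u f = free_extend R M (\<lambda>b. u (free_basis R b)) f"
proof -
  have m: "(\<lambda>b. u (free_basis R b)) \<in> S \<rightarrow> carrier M"
    by (intro funcsetI mod_hom_closed[OF u] free_basis_closed)
  have "u f = (\<Oplus>\<^bsub>M\<^esub>b\<in>A. f b \<odot>\<^bsub>M\<^esub> u (free_basis R b))"
    if "finite A" "{x. f x \<noteq> \<zero>\<^bsub>R\<^esub>} \<subseteq> A" "A \<subseteq> S" "f \<in> carrier (free_left_module R S)" for A f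
    using that
  proof (induction A arbitrary: f rule: finite_induct)
    case empty
    have "f x = \<zero>\<^bsub>R\<^esub>" for x
      using empty(1) by blast
    \<comment> \<open>\<open>mod_hom\<close> does not postulate that zero goes to zero; writing the
      zero family as \<open>0 f\<close> extracts this from compatibility with scalars.\<close>
    then have "\<zero>\<^bsub>R\<^esub> \<odot>\<^bsub>free_left_module R S\<^esub> f = f"
      unfolding free_left_module_simps fun_eq_iff by (simp only: R.l_null R.zero_closed simp_thms)
    then have "u f = u (\<zero>\<^bsub>R\<^esub> \<odot>\<^bsub>free_left_module R S\<^esub> f)" by (rule arg_cong[OF sym])
    also have "\<dots> = \<zero>\<^bsub>R\<^esub> \<odot>\<^bsub>M\<^esub> u f"
      by (rule mod_hom_smult[OF u R.zero_closed empty(3)])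
    also have "\<dots> = \<zero>\<^bsub>M\<^esub>"
      by (rule smult_zero_left[OF mod_hom_closed[OF u empty(3)]])
    finally show ?case by simp
  next
    case (insert b A)
    let ?f = "f(b := \<zero>\<^bsub>R\<^esub>)"
    have fc: "f x \<in> carrier R" for x
      using insert.prems(3) by (simp add: free_left_module_carrier_iff)
    have sub: "{x. ?f x \<noteq> \<zero>\<^bsub>R\<^esub>} \<subseteq> A" using insert.prems by auto
    have f': "?f \<in> carrier (free_left_module R S)"
      using finite_subset[OF sub insert.hyps(1)] subset_trans[OF sub] insert.prems(2) fc
      unfolding free_left_module_carrier_iff by simp
    have b: "free_basis R b \<in> carrier (free_left_module R S)"
      using insert.prems(2) by (intro free_basis_closed) auto
    have bf: "f b \<odot>\<^bsub>free_left_module R S\<^esub> free_basis R b \<in> carrier (free_left_module R S)"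
    proof -
      have "{x. f b \<otimes>\<^bsub>R\<^esub> free_basis R b x \<noteq> \<zero>\<^bsub>R\<^esub>} \<subseteq> {b}"
        using fc by (auto simp: free_basis_def)
      then have "finite {x. f b \<otimes>\<^bsub>R\<^esub> free_basis R b x \<noteq> \<zero>\<^bsub>R\<^esub>}"
        "{x. f b \<otimes>\<^bsub>R\<^esub> free_basis R b x \<noteq> \<zero>\<^bsub>R\<^esub>} \<subseteq> S"
        using insert.prems(2) by (auto intro: finite_subset[of _ "{b}"])
      then show ?thesis
        using fc unfolding free_left_module_carrier_iff by (simp add: free_basis_def)
    qed
    have mb: "f x \<odot>\<^bsub>M\<^esub> u (free_basis R x) \<in> carrier M" if "x \<in> insert b A" for x
      using m insert.prems(2) that by (intro smult_closed[OF fc]) (auto simp: Pi_iff)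
    have "f = ?f \<oplus>\<^bsub>free_left_module R S\<^esub> (f b \<odot>\<^bsub>free_left_module R S\<^esub> free_basis R b)"
      unfolding fun_eq_iff using fc by (simp add: free_basis_def)
    then have "u f = u (?f \<oplus>\<^bsub>free_left_module R S\<^esub> (f b \<odot>\<^bsub>free_left_module R S\<^esub> free_basis R b))"
      by (rule arg_cong)
    also have "\<dots> = u ?f \<oplus>\<^bsub>M\<^esub> f b \<odot>\<^bsub>M\<^esub> u (free_basis R b)"
      unfolding mod_hom_add[OF u f' bf] mod_hom_smult[OF u fc b] ..
    also have "u ?f = (\<Oplus>\<^bsub>M\<^esub>x\<in>A. ?f x \<odot>\<^bsub>M\<^esub> u (free_basis R x))"
      using insert.prems(2) by (intro insert.IH[OF sub _ f']) simp
    also have "\<dots> = (\<Oplus>\<^bsub>M\<^esub>x\<in>A. f x \<odot>\<^bsub>M\<^esub> u (free_basis R x))"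
      using insert.hyps(2) mb by (intro M.finsum_cong') (auto simp: Pi_iff)
    also have "\<dots> \<oplus>\<^bsub>M\<^esub> f b \<odot>\<^bsub>M\<^esub> u (free_basis R b) =
        f b \<odot>\<^bsub>M\<^esub> u (free_basis R b) \<oplus>\<^bsub>M\<^esub> (\<Oplus>\<^bsub>M\<^esub>x\<in>A. f x \<odot>\<^bsub>M\<^esub> u (free_basis R x))"
      using mb by (intro M.add.m_comm M.finsum_closed) (auto simp: Pi_iff)
    also have "\<dots> = (\<Oplus>\<^bsub>M\<^esub>x\<in>insert b A. f x \<odot>\<^bsub>M\<^esub> u (free_basis R x))"
      using insert.hyps mb by (intro M.finsum_insert[symmetric]) (auto simp: Pi_iff)
    finally show ?case .
  qed
  then show ?thesis
    using f unfolding free_extend_def by (simp add: free_left_module_carrier_iff)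
qed

end

text \<open>As \<open>P\<close> is a retract of a free module, preimages are chosen on basis
  elements, extended linearly and pulled back along \<open>s\<close>. Asking only for an inclusion
  of ranges, instead of surjectivity of \<open>g\<close>, avoids turning kernels into modules when
  lifting along an exact sequence.\<close>

lemma projective_lift:
  assumes P: "projective_module R P" and M: "left_module R M" and N: "left_module R N"
    and g: "g \<in> mod_hom R M N" and h: "h \<in> mod_hom R P N" and sub: "h ` carrier P \<subseteq> g ` carrier M"
  shows "\<exists>s\<in>mod_hom R P M. \<forall>x\<in>carrier P. g (s x) = h x"
proof -
  interpret P: left_module R P using P by (simp add: projective_module_def)
  interpret M: left_module R M by fact
  interpret N: left_module R N by fact
  let ?L = "free_left_module R (carrier P)"
  obtain s r where s: "s \<in> mod_hom R P ?L" and r: "r \<in> mod_hom R ?L P"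
    and rs: "\<And>x. x \<in> carrier P \<Longrightarrow> r (s x) = x"
    using P by (auto simp: projective_module_def)
  have hr: "h (r (free_basis R b)) \<in> g ` carrier M" if "b \<in> carrier P" for b
    using sub mod_hom_closed[OF r P.free_basis_closed[OF that]] by blast
  \<comment> \<open>A preimage under \<open>g\<close> of the value of \<open>h\<close> composed with
    \<open>r\<close> at each basis element.\<close>
  define m where "m = (\<lambda>b. SOME y. y \<in> carrier M \<and> g y = h (r (free_basis R b)))"
  have m: "m b \<in> carrier M" "g (m b) = h (r (free_basis R b))" if "b \<in> carrier P" for b
  proof -
    have "\<exists>y. y \<in> carrier M \<and> g y = h (r (free_basis R b))"
      using hr[OF that] by (metis imageE)
    from someI_ex[OF this] show "m b \<in> carrier M" "g (m b) = h (r (free_basis R b))"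
      by (auto simp: m_def)
  qed
  define t where "t = free_extend R M m"
  have t: "t \<in> mod_hom R ?L M"
    unfolding t_def by (rule M.free_extend_mod_hom) (use m in auto)
  have gt: "g (t f) = h (r f)" if f: "f \<in> carrier ?L" for f
  proof -
    have fc: "f x \<in> carrier R" and A: "finite {x. f x \<noteq> \<zero>\<^bsub>R\<^esub>}" "{x. f x \<noteq> \<zero>\<^bsub>R\<^esub>} \<subseteq> carrier P" for x
      using f by (auto simp: free_left_module_carrier_iff)
    have "g (t f) = (\<Oplus>\<^bsub>N\<^esub>b\<in>{x. f x \<noteq> \<zero>\<^bsub>R\<^esub>}. g (f b \<odot>\<^bsub>M\<^esub> m b))"
      unfolding t_def free_extend_def
      using A m fc by (intro M.mod_hom_finsum[OF g N]) (auto intro!: M.smult_closed)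
    also have "\<dots> = (\<Oplus>\<^bsub>N\<^esub>b\<in>{x. f x \<noteq> \<zero>\<^bsub>R\<^esub>}. f b \<odot>\<^bsub>N\<^esub> h (r (free_basis R b)))"
    proof (rule N.M.finsum_cong')
      show "(\<lambda>b. f b \<odot>\<^bsub>N\<^esub> h (r (free_basis R b))) \<in> {x. f x \<noteq> \<zero>\<^bsub>R\<^esub>} \<rightarrow> carrier N"
        using A fc mod_hom_closed[OF h mod_hom_closed[OF r P.free_basis_closed]]
        by (auto intro!: N.smult_closed)
      fix i assume "i \<in> {x. f x \<noteq> \<zero>\<^bsub>R\<^esub>}"
      then have "i \<in> carrier P" using A by blast
      then show "g (f i \<odot>\<^bsub>M\<^esub> m i) = f i \<odot>\<^bsub>N\<^esub> h (r (free_basis R i))"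
        using mod_hom_smult[OF g fc m(1)] m(2) by simp
    qed simp
    also have "\<dots> = h (r f)"
      using N.mod_hom_free_expansion[OF mod_hom_compose[OF r h] f] by (simp add: free_extend_def)
    finally show ?thesis .
  qed
  show ?thesis
  proof
    show "(\<lambda>x. t (s x)) \<in> mod_hom R P M" by (rule mod_hom_compose[OF s t])
    show "\<forall>x\<in>carrier P. g (t (s x)) = h x"
      using gt mod_hom_closed[OF s] rs by simp
  qed
qed

lemma (in left_module) smult_minus:
  assumes "a \<in> carrier R" "x \<in> carrier M"
  shows "a \<odot>\<^bsub>M\<^esub> (\<ominus>\<^bsub>M\<^esub> x) = \<ominus>\<^bsub>M\<^esub> (a \<odot>\<^bsub>M\<^esub> x)"
proof (rule M.minus_equality[symmetric])
  show "a \<odot>\<^bsub>M\<^esub> (\<ominus>\<^bsub>M\<^esub> x) \<oplus>\<^bsub>M\<^esub> a \<odot>\<^bsub>M\<^esub> x = \<zero>\<^bsub>M\<^esub>"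
    using assms by (simp flip: smult_r_distr add: M.l_neg smult_zero_right)
qed (use assms in \<open>auto intro: smult_closed\<close>)

lemma (in left_module) mod_hom_minus:
  assumes h: "h \<in> mod_hom R M N" and N: "left_module R N" and x: "x \<in> carrier M"
  shows "h (\<ominus>\<^bsub>M\<^esub> x) = \<ominus>\<^bsub>N\<^esub> h x"
proof -
  interpret N: left_module R N by fact
  have "h (\<ominus>\<^bsub>M\<^esub> x) \<oplus>\<^bsub>N\<^esub> h x = h \<zero>\<^bsub>M\<^esub>"
    using x by (simp flip: mod_hom_add[OF h] add: M.l_neg)
  then show ?thesis
    using mod_hom_closed[OF h] x mod_hom_zero[OF h N] by (intro N.M.minus_equality[symmetric]) auto
qed

lemma mod_hom_diff:
  assumes N: "left_module R N" and f: "f \<in> mod_hom R M N" and g: "g \<in> mod_hom R M N"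
  shows "(\<lambda>x. f x \<ominus>\<^bsub>N\<^esub> g x) \<in> mod_hom R M N"
proof -
  interpret N: left_module R N by fact
  note c = mod_hom_closed[OF f] mod_hom_closed[OF g]
  show ?thesis
    unfolding mod_hom_def
  proof (intro CollectI conjI ballI funcsetI)
    fix x y assume xy: "x \<in> carrier M" "y \<in> carrier M"
    show "f (x \<oplus>\<^bsub>M\<^esub> y) \<ominus>\<^bsub>N\<^esub> g (x \<oplus>\<^bsub>M\<^esub> y) = (f x \<ominus>\<^bsub>N\<^esub> g x) \<oplus>\<^bsub>N\<^esub> (f y \<ominus>\<^bsub>N\<^esub> g y)"
      using c[OF xy(1)] c[OF xy(2)]
      by (simp add: mod_hom_add[OF f xy] mod_hom_add[OF g xy] a_minus_def N.M.minus_add N.M.a_ac)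
  next
    fix a x assume ax: "a \<in> carrier R" "x \<in> carrier M"
    show "f (a \<odot>\<^bsub>M\<^esub> x) \<ominus>\<^bsub>N\<^esub> g (a \<odot>\<^bsub>M\<^esub> x) = a \<odot>\<^bsub>N\<^esub> (f x \<ominus>\<^bsub>N\<^esub> g x)"
      using c[OF ax(2)] ax
      by (simp add: mod_hom_smult[OF f ax] mod_hom_smult[OF g ax] a_minus_def N.smult_r_distr N.smult_minus)
  qed (use c in auto)
qed

lemma (in left_module) central_smult_mod_hom:
  assumes a: "a \<in> carrier R" and comm: "\<And>b. b \<in> carrier R \<Longrightarrow> a \<otimes>\<^bsub>R\<^esub> b = b \<otimes>\<^bsub>R\<^esub> a"
  shows "(\<lambda>x. a \<odot>\<^bsub>M\<^esub> x) \<in> mod_hom R M M"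
proof -
  have "a \<odot>\<^bsub>M\<^esub> (b \<odot>\<^bsub>M\<^esub> x) = b \<odot>\<^bsub>M\<^esub> (a \<odot>\<^bsub>M\<^esub> x)" if "b \<in> carrier R" "x \<in> carrier M" for b x
    using smult_assoc1[OF a that] smult_assoc1[OF that(1) a that(2)] comm[OF that(1)] by simp
  then show ?thesis
    using a smult_closed smult_r_distr by (simp add: mod_hom_def)
qed

lemma projective_resolutionD:
  assumes "projective_resolution G F d \<epsilon>"
  shows "left_module (group_ring G) (F i)"
    and "d (Suc i) \<in> mod_hom (group_ring G) (F (Suc i)) (F i)"
    and "\<And>x. x \<in> carrier (F (Suc (Suc i))) \<Longrightarrow> d (Suc i) (d (Suc (Suc i)) x) = \<zero>\<^bsub>F i\<^esub>"
proof -
  show "left_module (group_ring G) (F i)"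
    using assms by (simp add: projective_resolution_def projective_module_def)
  have ex: "exact_augmented G (Suc (Suc i)) F d \<epsilon>"
    using assms by (simp add: projective_resolution_def)
  then show "d (Suc i) \<in> mod_hom (group_ring G) (F (Suc i)) (F i)"
    by (simp add: exact_augmented_def)
  have "d (Suc (Suc i)) ` carrier (F (Suc (Suc i))) = mod_ker (F (Suc i)) (F i) (d (Suc i))"
    using ex by (simp add: exact_augmented_def)
  then show "d (Suc i) (d (Suc (Suc i)) x) = \<zero>\<^bsub>F i\<^esub>" if "x \<in> carrier (F (Suc (Suc i)))" for x
    using that by (auto simp: mod_ker_def)
qed

text \<open>Multiplication by a central element annihilating \<open>\<int>\<close> lifts the zero map of \<open>\<int>\<close>, so it is
  homotopic to zero.\<close>

lemma central_null_homotopy: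
  assumes G: "group G" and z: "z \<in> group_center G" and res: "projective_resolution G F d \<epsilon>"
  defines "\<alpha> \<equiv> frag_of z - frag_of \<one>\<^bsub>G\<^esub>"
  obtains s where "\<And>i. s i \<in> mod_hom (group_ring G) (F i) (F (Suc i))"
    and "\<And>x. x \<in> carrier (F 0) \<Longrightarrow> \<alpha> \<odot>\<^bsub>F 0\<^esub> x = d 1 (s 0 x)"
    and "\<And>i x. x \<in> carrier (F (Suc i)) \<Longrightarrow>
      \<alpha> \<odot>\<^bsub>F (Suc i)\<^esub> x = d (Suc (Suc i)) (s (Suc i) x) \<oplus>\<^bsub>F (Suc i)\<^esub> s i (d (Suc i) x)"
proof -
  interpret G: group G by fact
  let ?R = "group_ring G"
  have proj: "projective_module ?R (F i)" for i
    using res by (simp add: projective_resolution_def)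
  note lm = projective_resolutionD(1)[OF res] and d = projective_resolutionD(2)[OF res]
    and dd = projective_resolutionD(3)[OF res]
  interpret F: left_module ?R "F i" for i by (rule lm)
  have ex: "exact_augmented G n F d \<epsilon>" for n
    using res by (simp add: projective_resolution_def)
  have eps: "\<epsilon> \<in> mod_hom ?R (F 0) trivial_module"
    using ex[of 0] by (simp add: exact_augmented_def)
  have im1: "d 1 ` carrier (F 1) = mod_ker (F 0) trivial_module \<epsilon>"
    using ex[of 1] by (simp add: exact_augmented_def)
  have im: "d (Suc (Suc i)) ` carrier (F (Suc (Suc i))) = mod_ker (F (Suc i)) (F i) (d (Suc i))" for i
    using ex[of "Suc (Suc i)"] by (simp add: exact_augmented_def)
  have zc: "z \<in> carrier G" using z by (simp add: group_center_def)
  have \<alpha>: "\<alpha> \<in> carrier ?R"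
    using G.keys_group_ring_diff[OF zc] by (simp add: \<alpha>_def)
  have mul: "(\<lambda>x. \<alpha> \<odot>\<^bsub>F i\<^esub> x) \<in> mod_hom ?R (F i) (F i)" for i
    using G.group_ring_central[OF z] \<alpha>
    by (intro F.central_smult_mod_hom) (simp_all add: \<alpha>_def del: group_ring_simps(5))
  have mulc: "\<alpha> \<odot>\<^bsub>F i\<^esub> x \<in> carrier (F i)" if "x \<in> carrier (F i)" for i x
    using F.smult_closed[OF \<alpha> that] .
  \<comment> \<open>The augmentation of \<open>z - 1\<close> is zero, so it annihilates the trivial
    module. Hence \<open>\<alpha> x\<close> lies in the kernel of \<open>\<epsilon>\<close> and
    lifts through \<open>d 1\<close>, which starts the homotopy.\<close>
  have aug: "(\<Sum>g\<in>Poly_Mapping.keys \<alpha>. Poly_Mapping.lookup \<alpha> g) = 0"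
  proof -
    have "(\<Sum>g\<in>Poly_Mapping.keys \<alpha>. Poly_Mapping.lookup \<alpha> g) = (\<Sum>g\<in>{z, \<one>\<^bsub>G\<^esub>}. Poly_Mapping.lookup \<alpha> g)"
      unfolding \<alpha>_def using keys_diff[of "frag_of z" "frag_of \<one>\<^bsub>G\<^esub>"]
      by (intro sum.mono_neutral_left) (auto simp: in_keys_iff)
    also have "\<dots> = 0" by (cases "z = \<one>\<^bsub>G\<^esub>") (auto simp: \<alpha>_def lookup_minus)
    finally show ?thesis .
  qed
  \<comment> \<open>The choice is dependent, since each map lifts one built from its predecessor.
    \<open>P\<close> records \<open>d s d = d \<alpha>\<close>, which says that
    \<open>\<alpha> - s d\<close> takes values in the kernel of \<open>d\<close> and so can be
    lifted again; its last clause keeps the equation in degree 0. \<open>Q\<close> is the homotopy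
    identity linking two consecutive maps.\<close>
  define P where "P = (\<lambda>i s. s \<in> mod_hom ?R (F i) (F (Suc i)) \<and>
    (\<forall>x\<in>carrier (F (Suc i)). d (Suc i) (s (d (Suc i) x)) = d (Suc i) (\<alpha> \<odot>\<^bsub>F (Suc i)\<^esub> x)) \<and>
    (i = 0 \<longrightarrow> (\<forall>x\<in>carrier (F 0). d 1 (s x) = \<alpha> \<odot>\<^bsub>F 0\<^esub> x)))"
  define Q where "Q = (\<lambda>i s s'. \<forall>x\<in>carrier (F (Suc i)).
    \<alpha> \<odot>\<^bsub>F (Suc i)\<^esub> x = d (Suc (Suc i)) (s' x) \<oplus>\<^bsub>F (Suc i)\<^esub> s (d (Suc i) x))"
  have "\<exists>s. \<forall>i. P i (s i) \<and> Q i (s i) (s (Suc i))"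
  proof (rule dependent_nat_choice)
    have "(\<lambda>x. \<alpha> \<odot>\<^bsub>F 0\<^esub> x) ` carrier (F 0) \<subseteq> d 1 ` carrier (F 1)"
      unfolding im1 using mulc mod_hom_smult[OF eps \<alpha>] aug by (auto simp: mod_ker_def trivial_module_def)
    from projective_lift[OF proj lm lm _ mul this]
    obtain s where s: "s \<in> mod_hom ?R (F 0) (F 1)" "\<forall>x\<in>carrier (F 0). d 1 (s x) = \<alpha> \<odot>\<^bsub>F 0\<^esub> x"
      using d[of 0] by auto
    have "P 0 s"
      unfolding P_def using s mod_hom_closed[OF d] mod_hom_smult[OF d \<alpha>] by simp
    then show "\<exists>s. P 0 s" by (rule exI[of "P 0"])
  next
    fix s i assume P: "P i s"
    then have s: "s \<in> mod_hom ?R (F i) (F (Suc i))" by (simp add: P_def)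
    \<comment> \<open>By the invariant in \<open>P\<close>, this map lands in the kernel of
      \<open>d (Suc i)\<close>, which exactness identifies with the range of the next boundary map.
      Its lift is the next homotopy map.\<close>
    let ?h = "\<lambda>x. \<alpha> \<odot>\<^bsub>F (Suc i)\<^esub> x \<ominus>\<^bsub>F (Suc i)\<^esub> s (d (Suc i) x)"
    have h: "?h \<in> mod_hom ?R (F (Suc i)) (F (Suc i))"
      by (rule mod_hom_diff[OF lm mul mod_hom_compose[OF d s]])
    have sd: "s (d (Suc i) x) \<in> carrier (F (Suc i))" if "x \<in> carrier (F (Suc i))" for x
      using mod_hom_closed[OF s mod_hom_closed[OF d that]] .
    have "?h ` carrier (F (Suc i)) \<subseteq> d (Suc (Suc i)) ` carrier (F (Suc (Suc i)))"
      unfolding im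
    proof (clarsimp simp: mod_ker_def, intro conjI)
      fix x assume x: "x \<in> carrier (F (Suc i))"
      show "?h x \<in> carrier (F (Suc i))" using mod_hom_closed[OF h x] .
      have "d (Suc i) (?h x) = d (Suc i) (\<alpha> \<odot>\<^bsub>F (Suc i)\<^esub> x) \<oplus>\<^bsub>F i\<^esub> d (Suc i) (\<ominus>\<^bsub>F (Suc i)\<^esub> s (d (Suc i) x))"
        unfolding a_minus_def by (intro mod_hom_add[OF d mulc[OF x]] F.M.a_inv_closed sd x)
      also have "\<dots> = d (Suc i) (\<alpha> \<odot>\<^bsub>F (Suc i)\<^esub> x) \<oplus>\<^bsub>F i\<^esub> (\<ominus>\<^bsub>F i\<^esub> d (Suc i) (\<alpha> \<odot>\<^bsub>F (Suc i)\<^esub> x))"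
        unfolding F.mod_hom_minus[OF d lm sd[OF x]] using P x by (simp add: P_def)
      also have "\<dots> = \<zero>\<^bsub>F i\<^esub>" by (rule F.M.r_neg[OF mod_hom_closed[OF d mulc[OF x]]])
      finally show "d (Suc i) (?h x) = \<zero>\<^bsub>F i\<^esub>" .
    qed
    from projective_lift[OF proj lm lm d h this]
    obtain s' where s': "s' \<in> mod_hom ?R (F (Suc i)) (F (Suc (Suc i)))"
      and ds': "\<And>x. x \<in> carrier (F (Suc i)) \<Longrightarrow> d (Suc (Suc i)) (s' x) = ?h x"
      by auto
    have "Q i s s'"
      unfolding Q_def
    proof
      fix x assume x: "x \<in> carrier (F (Suc i))"
      show "\<alpha> \<odot>\<^bsub>F (Suc i)\<^esub> x = d (Suc (Suc i)) (s' x) \<oplus>\<^bsub>F (Suc i)\<^esub> s (d (Suc i) x)"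
        unfolding ds'[OF x] a_minus_def
        using sd[OF x] mulc[OF x] by (simp add: F.M.a_assoc F.M.l_neg)
    qed
    \<comment> \<open>In \<open>d s' d x = \<alpha> (d x) - s (d (d x))\<close> the last term
      vanishes since \<open>d d = 0\<close>, so the invariant is restored.\<close>
    moreover have "P (Suc i) s'"
      unfolding P_def
    proof (intro conjI ballI s')
      fix x assume x: "x \<in> carrier (F (Suc (Suc i)))"
      have dx: "d (Suc (Suc i)) x \<in> carrier (F (Suc i))" using mod_hom_closed[OF d x] .
      have "s (d (Suc i) (d (Suc (Suc i)) x)) = \<zero>\<^bsub>F (Suc i)\<^esub>"
        unfolding dd[OF x] by (rule F.mod_hom_zero[OF s lm])
      moreover have "\<ominus>\<^bsub>F (Suc i)\<^esub> \<zero>\<^bsub>F (Suc i)\<^esub> = \<zero>\<^bsub>F (Suc i)\<^esub>"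
        by (rule F.M.minus_equality) simp_all
      ultimately show "d (Suc (Suc i)) (s' (d (Suc (Suc i)) x)) = d (Suc (Suc i)) (\<alpha> \<odot>\<^bsub>F (Suc (Suc i))\<^esub> x)"
        unfolding ds'[OF dx] mod_hom_smult[OF d \<alpha> x]
        by (simp only: a_minus_def F.M.r_zero[OF mulc[OF dx]])
    qed simp
    ultimately show "\<exists>s'. P (Suc i) s' \<and> Q i s s'" by blast
  qed
  then obtain s where s: "\<And>i. P i (s i)" "\<And>i. Q i (s i) (s (Suc i))" by blast
  show thesis
  proof (rule that[of s])
    show "s i \<in> mod_hom ?R (F i) (F (Suc i))" for i using s(1)[of i] by (simp add: P_def)
    show "\<alpha> \<odot>\<^bsub>F 0\<^esub> x = d 1 (s 0 x)" if "x \<in> carrier (F 0)" for x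
      using s(1)[of 0] that by (simp add: P_def)
    show "\<alpha> \<odot>\<^bsub>F (Suc i)\<^esub> x = d (Suc (Suc i)) (s (Suc i) x) \<oplus>\<^bsub>F (Suc i)\<^esub> s i (d (Suc i) x)"
      if "x \<in> carrier (F (Suc i))" for i x
      using s(2)[of i] that by (simp add: Q_def)
  qed
qed

section \<open>Quotients by closures\<close>

lemma limitin_imp_closure_of:
  assumes "limitin T u l sequentially" and "\<And>n. u n \<in> B"
  shows "l \<in> T closure_of B"
  using assms unfolding in_closure_of limitin_sequentially by (meson order_refl)

text \<open>\<open>B\<close> and \<open>Z\<close> have the same closure. Translation by an element
  of \<open>Z\<close> preserves \<open>Z\<close>, hence by continuity also the closure, so all
  cosets by elements of \<open>Z\<close> coincide. Only separate continuity of translations is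
  assumed, and the closure is taken in the whole group.\<close>

lemma trivial_group_Mod_closure:
  assumes A: "comm_group A" and top: "topspace T = carrier A"
    and trans: "\<And>a. a \<in> carrier A \<Longrightarrow> continuous_map T T (\<lambda>x. x \<otimes>\<^bsub>A\<^esub> a)"
    and Z: "subgroup Z A" and BZ: "B \<subseteq> Z" and ZB: "Z \<subseteq> T closure_of B"
  shows "trivial_group (A\<lparr>carrier := Z\<rparr> Mod (T closure_of B))"
proof -
  interpret A: comm_group A by fact
  interpret Z: subgroup Z A by fact
  define H where "H = T closure_of B"
  have HZ: "H = T closure_of Z"
    unfolding H_def
    by (intro subset_antisym closure_of_mono[OF BZ] closure_of_minimal[OF ZB] closedin_closure_of)
  have Hc: "H \<subseteq> carrier A" unfolding H_def top[symmetric] by (rule closure_of_subset_topspace)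
  have ZH: "Z \<subseteq> H" using ZB by (simp add: H_def)
  \<comment> \<open>To see that translation by \<open>a\<close> preserves the closed set
    \<open>H\<close>, it suffices by continuity to test it on the dense part
    \<open>Z\<close>.\<close>
  have move: "h \<otimes>\<^bsub>A\<^esub> a \<in> H" if "h \<in> H" and a: "a \<in> carrier A" and "\<And>x. x \<in> Z \<Longrightarrow> x \<otimes>\<^bsub>A\<^esub> a \<in> H" for h a
  proof -
    have "(\<lambda>x. x \<otimes>\<^bsub>A\<^esub> a) ` H \<subseteq> T closure_of ((\<lambda>x. x \<otimes>\<^bsub>A\<^esub> a) ` Z)"
      unfolding HZ by (rule continuous_map_image_closure_subset[OF trans[OF a]])
    also have "\<dots> \<subseteq> T closure_of H"
      using that(3) by (intro closure_of_mono) auto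
    also have "\<dots> = H" by (simp add: H_def)
    finally show ?thesis using that(1) by blast
  qed
  have right: "h \<otimes>\<^bsub>A\<^esub> a \<in> H" if "h \<in> H" "a \<in> Z" for h a
  proof (rule move[OF that(1)])
    show "a \<in> carrier A" using that(2) by simp
    show "x \<otimes>\<^bsub>A\<^esub> a \<in> H" if "x \<in> Z" for x
      using ZH Z.m_closed[OF that \<open>a \<in> Z\<close>] by blast
  qed
  \<comment> \<open>Two passes replace joint continuity: for \<open>x\<close> in \<open>Z\<close>,
    commutativity turns \<open>x k\<close> into \<open>k x\<close>, which the case of translations
    by \<open>Z\<close> covers; density then extends this to all of \<open>H\<close>.\<close>
  have HH: "h \<otimes>\<^bsub>A\<^esub> k \<in> H" if h: "h \<in> H" and k: "k \<in> H" for h k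
  proof (rule move[OF h])
    show "k \<in> carrier A" using k Hc by blast
    then show "x \<otimes>\<^bsub>A\<^esub> k \<in> H" if "x \<in> Z" for x
      using right[OF k that] that A.m_comm[of x k] by simp
  qed
  \<comment> \<open>The quotient multiplies cosets as sets, so its single element must be idempotent
    for the quotient to be a group.\<close>
  have mult: "H <#>\<^bsub>A\<^esub> H = H"
  proof
    show "H <#>\<^bsub>A\<^esub> H \<subseteq> H" using HH by (auto simp: set_mult_def)
    show "H \<subseteq> H <#>\<^bsub>A\<^esub> H"
    proof
      fix h assume "h \<in> H"
      moreover have "\<one>\<^bsub>A\<^esub> \<otimes>\<^bsub>A\<^esub> h = h" "\<one>\<^bsub>A\<^esub> \<in> H" using \<open>h \<in> H\<close> Hc ZH by auto
      ultimately show "h \<in> H <#>\<^bsub>A\<^esub> H" unfolding set_mult_def by force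
    qed
  qed
  have coset: "H #>\<^bsub>A\<^esub> a = H" if a: "a \<in> Z" for a
  proof
    show "H #>\<^bsub>A\<^esub> a \<subseteq> H" using right a by (auto simp: r_coset_def)
    show "H \<subseteq> H #>\<^bsub>A\<^esub> a"
    proof
      fix h assume h: "h \<in> H"
      have "h \<otimes>\<^bsub>A\<^esub> inv\<^bsub>A\<^esub> a \<in> H" using right[OF h] a by simp
      moreover have "(h \<otimes>\<^bsub>A\<^esub> inv\<^bsub>A\<^esub> a) \<otimes>\<^bsub>A\<^esub> a = h"
        using h Hc a by (auto simp: A.m_assoc)
      ultimately show "h \<in> H #>\<^bsub>A\<^esub> a" unfolding r_coset_def by force
    qed
  qed
  have "carrier (A\<lparr>carrier := Z\<rparr> Mod H) = {H}"
  proof -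
    have "Z \<noteq> {}" using Z.one_closed by blast
    then show ?thesis by (simp add: FactGroup_def RCOSETS_def coset)
  qed
  moreover have "group (A\<lparr>carrier := Z\<rparr> Mod H)"
    by (rule groupI) (use calculation mult in \<open>auto simp: FactGroup_def\<close>)
  ultimately show ?thesis
    by (simp add: trivial_group_def H_def)
qed

section \<open>Cohomology\<close>

lemma Hom_lp_comm_group:
  fixes G :: "('g, 'x) monoid_scheme" and F :: "('g \<Rightarrow>\<^sub>0 int, 'm) module"
  assumes G: "group G" and p: "p \<ge> 1" and F: "left_module (group_ring G) F"
  shows "comm_group (Hom_group (group_ring G) F (lp_module G p))"
proof -
  interpret G: group G by fact
  interpret F: left_module "group_ring G" F by fact
  let ?L = "lp_module G p"
  let ?H = "Hom_group (group_ring G) F ?L"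
  have [simp]: "mult ?H \<phi> \<psi> = (\<lambda>x\<in>carrier F. \<lambda>g. \<phi> x g + \<psi> x g)" "one ?H = (\<lambda>x\<in>carrier F. \<lambda>g. 0)"
    "carrier ?H = mod_hom (group_ring G) F ?L \<inter> extensional (carrier F)" for \<phi> \<psi>
    by (simp_all add: Hom_group_def)
  have zero: "a \<odot>\<^bsub>?L\<^esub> (\<lambda>g. 0) = (\<lambda>g. 0)" for a
    by (simp add: lp_module_smult lp_translate_def)
  have neg: "a \<odot>\<^bsub>?L\<^esub> (\<lambda>g. - f g) = (\<lambda>g. - (a \<odot>\<^bsub>?L\<^esub> f) g)" for a f
    by (auto simp: lp_module_smult lp_translate_def fun_eq_iff simp flip: sum_negf intro!: sum.cong)
  have neg_closed: "(\<lambda>g. - f g) \<in> lp_space G p" if "f \<in> lp_space G p" for f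
    using lp_scale(1)[OF p that, of "-1"] by simp
  have ext: "\<phi> = \<psi>" if "\<phi> \<in> extensional (carrier F)" "\<psi> \<in> extensional (carrier F)"
    "\<And>x g. x \<in> carrier F \<Longrightarrow> \<phi> x g = \<psi> x g" for \<phi> \<psi> :: "'m \<Rightarrow> 'g \<Rightarrow> complex"
    using that by (intro extensionalityI[of _ "carrier F"]) auto
  show ?thesis
  proof (rule comm_groupI)
    fix \<phi> \<psi> assume \<phi>: "\<phi> \<in> carrier ?H" and \<psi>: "\<psi> \<in> carrier ?H"
    then show "\<phi> \<otimes>\<^bsub>?H\<^esub> \<psi> \<in> carrier ?H"
      by (auto simp: mod_hom_def Pi_iff lp_add_closed[OF p] lp_module_smult_add F.smult_closed add_ac)
    show "\<phi> \<otimes>\<^bsub>?H\<^esub> \<psi> = \<psi> \<otimes>\<^bsub>?H\<^esub> \<phi>"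
      by (simp add: add.commute)
    fix \<theta> assume "\<theta> \<in> carrier ?H"
    show "\<phi> \<otimes>\<^bsub>?H\<^esub> \<psi> \<otimes>\<^bsub>?H\<^esub> \<theta> = \<phi> \<otimes>\<^bsub>?H\<^esub> (\<psi> \<otimes>\<^bsub>?H\<^esub> \<theta>)"
      by (rule ext) (auto simp: add.assoc)
  next
    show "\<one>\<^bsub>?H\<^esub> \<in> carrier ?H"
      by (auto simp: mod_hom_def lp_zero[OF p] zero F.smult_closed)
    fix \<phi> assume \<phi>: "\<phi> \<in> carrier ?H"
    show "\<one>\<^bsub>?H\<^esub> \<otimes>\<^bsub>?H\<^esub> \<phi> = \<phi>"
      by (rule ext) (use \<phi> in auto)
    show "\<exists>\<psi>\<in>carrier ?H. \<psi> \<otimes>\<^bsub>?H\<^esub> \<phi> = \<one>\<^bsub>?H\<^esub>"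
    proof
      show "(\<lambda>x\<in>carrier F. \<lambda>g. - \<phi> x g) \<in> carrier ?H"
        using \<phi> by (auto simp: mod_hom_def Pi_iff neg_closed neg F.smult_closed)
      show "(\<lambda>x\<in>carrier F. \<lambda>g. - \<phi> x g) \<otimes>\<^bsub>?H\<^esub> \<phi> = \<one>\<^bsub>?H\<^esub>"
        by (rule ext) auto
    qed
  qed
qed

lemma topspace_Hom_lp_topology:
  assumes p: "p \<ge> 1"
  shows "topspace (Hom_lp_topology G p F) = carrier (Hom_group (group_ring G) F (lp_module G p))"
  using p by (auto simp: Hom_lp_topology_def Hom_group_def mod_hom_def PiE_def)

lemma continuous_map_Hom_lp_translation:
  assumes p: "p \<ge> 1" and H: "comm_group (Hom_group (group_ring G) F (lp_module G p))"
    and \<psi>: "\<psi> \<in> carrier (Hom_group (group_ring G) F (lp_module G p))"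
  shows "continuous_map (Hom_lp_topology G p F) (Hom_lp_topology G p F)
    (\<lambda>\<phi>. \<phi> \<otimes>\<^bsub>Hom_group (group_ring G) F (lp_module G p)\<^esub> \<psi>)"
proof -
  let ?H = "Hom_group (group_ring G) F (lp_module G p)"
  interpret H: comm_group ?H by fact
  have mult: "mult ?H \<phi> \<psi> = (\<lambda>x\<in>carrier F. \<lambda>g. \<phi> x g + \<psi> x g)" for \<phi> \<psi>
    by (simp add: Hom_group_def)
  have ev: "continuous_map (Hom_lp_topology G p F) (lp_topology G p) (\<lambda>\<phi> g. \<phi> x g + \<psi> x g)"
    if "x \<in> carrier F" for x
  proof -
    have "continuous_map (Hom_lp_topology G p F) (lp_topology G p) (\<lambda>\<phi>. \<phi> x)"
      unfolding Hom_lp_topology_def using that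
      by (intro continuous_map_from_subtopology continuous_map_product_projection)
    moreover have "\<psi> x \<in> lp_space G p" using \<psi> that by (auto simp: Hom_group_def mod_hom_def)
    ultimately show ?thesis
      using continuous_map_compose[OF _ continuous_map_lp_translation[OF p], of _ G "\<lambda>\<phi>. \<phi> x" "\<psi> x"]
      by (simp add: o_def)
  qed
  have "\<phi> \<otimes>\<^bsub>?H\<^esub> \<psi> \<in> carrier ?H" if "\<phi> \<in> topspace (Hom_lp_topology G p F)" for \<phi>
    using that \<psi> by (simp add: topspace_Hom_lp_topology[OF p])
  moreover have "continuous_map (Hom_lp_topology G p F) (product_topology (\<lambda>x. lp_topology G p) (carrier F))
      (\<lambda>\<phi>. \<phi> \<otimes>\<^bsub>?H\<^esub> \<psi>)"
    unfolding mult continuous_map_componentwise using ev by auto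
  ultimately show ?thesis
    \<comment> \<open>Only the codomain is expanded into a subtopology; the domain stays folded so
      that the two facts above match.\<close>
    unfolding Hom_lp_topology_def[of G p F, THEN arg_cong[of _ _ "\<lambda>T. continuous_map (Hom_lp_topology G p F) T f" for f]]
    by (auto simp: continuous_map_in_subtopology)
qed

text \<open>For a cocycle \<open>\<phi>\<close>, equivariance moves \<open>\<alpha>\<close> in
  \<open>\<alpha> Q\<^sub>N \<phi>\<close> to the argument. There the homotopy splits it into
  \<open>d s + s d\<close>; the cocycle condition kills the first part, and the second is the
  coboundary of \<open>Q\<^sub>N \<phi> s\<close>. The ergodic theorem at each argument is precisely
  convergence in the \<open>Hom\<close> topology.\<close>

lemma reduced_lp_cohomology_trivial:
  fixes G :: "('g, 'x) monoid_scheme" and F :: "nat \<Rightarrow> ('g \<Rightarrow>\<^sub>0 int, 'm) module"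
  assumes p: "p > 1" and G: "group G" and z: "z \<in> group_center G" "infinite_order G z"
    and res: "projective_resolution G F d \<epsilon>"
  shows "trivial_group (reduced_lp_cohomology G p F d i)"
proof -
  interpret G: group G by fact
  let ?R = "group_ring G" and ?L = "lp_module G p"
  let ?H = "\<lambda>i. Hom_group ?R (F i) ?L"
  have p1: "p \<ge> 1" using p by simp
  note lm = projective_resolutionD(1)[OF res] and d = projective_resolutionD(2)[OF res]
    and dd = projective_resolutionD(3)[OF res]
  interpret F: left_module ?R "F j" for j by (rule lm)
  define \<alpha> where "\<alpha> = frag_of z - frag_of \<one>\<^bsub>G\<^esub>"
  have \<alpha>: "\<alpha> \<in> carrier ?R"
    using G.keys_group_ring_diff z by (simp add: \<alpha>_def group_center_def)
  obtain s where s: "\<And>i. s i \<in> mod_hom ?R (F i) (F (Suc i))"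
    and s0: "\<And>x. x \<in> carrier (F 0) \<Longrightarrow> \<alpha> \<odot>\<^bsub>F 0\<^esub> x = d 1 (s 0 x)"
    and sSuc: "\<And>i x. x \<in> carrier (F (Suc i)) \<Longrightarrow>
      \<alpha> \<odot>\<^bsub>F (Suc i)\<^esub> x = d (Suc (Suc i)) (s (Suc i) x) \<oplus>\<^bsub>F (Suc i)\<^esub> s i (d (Suc i) x)"
    using central_null_homotopy[OF G z(1) res] unfolding \<alpha>_def by metis
  obtain Q where Q: "\<And>N. Q N \<in> mod_hom ?R ?L ?L"
    and lim: "\<And>f. f \<in> lp_space G p \<Longrightarrow> limitin (lp_topology G p) (\<lambda>N. \<alpha> \<odot>\<^bsub>?L\<^esub> Q N f) f sequentially"
    using G.lp_mean_ergodic[OF p z] unfolding \<alpha>_def by metis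
  have H: "comm_group (?H i)" for i by (rule Hom_lp_comm_group[OF G p1 lm])
  have zero: "\<phi> \<zero>\<^bsub>F i\<^esub> = (\<lambda>g. 0)" if "\<phi> \<in> mod_hom ?R (F i) ?L" for \<phi> i
  proof -
    have "(0::'g \<Rightarrow>\<^sub>0 int) \<odot>\<^bsub>F i\<^esub> \<zero>\<^bsub>F i\<^esub> = \<zero>\<^bsub>F i\<^esub>"
      using F.smult_zero_left[of "\<zero>\<^bsub>F i\<^esub>" i] by simp
    then show ?thesis
      using mod_hom_smult[OF that, of 0 "\<zero>\<^bsub>F i\<^esub>"] by (simp add: lp_module_smult)
  qed
  have coc: "\<phi> \<in> lp_cocycles G p F d i \<longleftrightarrow> \<phi> \<in> carrier (?H i) \<and>
      (\<forall>x\<in>carrier (F (Suc i)). \<phi> (d (Suc i) x) = (\<lambda>g. 0))" for \<phi> i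
    by (auto simp: lp_cocycles_def kernel_def Hom_group_def compose_def fun_eq_iff restrict_def)
  have sub: "subgroup (lp_cocycles G p F d i) (?H i)"
  proof -
    interpret H: comm_group "?H i" by (rule H)
    interpret H': comm_group "?H (Suc i)" by (rule H)
    have hm: "(\<lambda>\<phi>. compose (carrier (F (Suc i))) \<phi> (d (Suc i))) \<in> hom (?H i) (?H (Suc i))"
      using mod_hom_closed[OF d] d
      by (auto simp: hom_def Hom_group_def compose_def mod_hom_def Pi_iff fun_eq_iff F.smult_closed)
    show ?thesis
      unfolding lp_cocycles_def
      by (rule group_hom.subgroup_kernel[OF group_hom.intro[OF H.is_group H'.is_group group_hom_axioms.intro[OF hm]]])
  qed
  have BZ: "lp_coboundaries G p F d i \<subseteq> lp_cocycles G p F d i"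
  proof (cases i)
    case 0
    then show ?thesis using subgroup.one_closed[OF sub] by (simp add: lp_coboundaries_def)
  next
    case (Suc k)
    have "compose (carrier (F (Suc k))) \<phi> (d (Suc k)) \<in> lp_cocycles G p F d (Suc k)"
      if "\<phi> \<in> carrier (?H k)" for \<phi>
      unfolding coc using that mod_hom_closed[OF d] d dd zero[of \<phi> k]
      by (auto simp: Hom_group_def compose_def mod_hom_def Pi_iff F.smult_closed)
    then show ?thesis using Suc by (auto simp: lp_coboundaries_def)
  qed
  have "\<phi> \<in> Hom_lp_topology G p (F i) closure_of lp_coboundaries G p F d i"
    if \<phi>: "\<phi> \<in> lp_cocycles G p F d i" for \<phi>
  proof -
    have hom: "\<phi> \<in> mod_hom ?R (F i) ?L" and ext: "\<phi> \<in> extensional (carrier (F i))"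
      and \<phi>d: "\<And>x. x \<in> carrier (F (Suc i)) \<Longrightarrow> \<phi> (d (Suc i) x) = (\<lambda>g. 0)"
      using \<phi> by (auto simp: coc Hom_group_def)
    define u where "u = (\<lambda>N. \<lambda>x\<in>carrier (F i). \<alpha> \<odot>\<^bsub>?L\<^esub> Q N (\<phi> x))"
    have Q0: "Q N (\<lambda>g. 0) = (\<lambda>g. 0)" for N
    proof -
      have "(0::'g \<Rightarrow>\<^sub>0 int) \<odot>\<^bsub>?L\<^esub> (\<lambda>g. 0) = (\<lambda>g. 0)" by (simp add: lp_module_smult)
      then show ?thesis
        using mod_hom_smult[OF Q, of 0 "\<lambda>g. 0" N] lp_zero[OF p1, of G] by (simp add: lp_module_smult)
    qed
    have u_eq: "u N x = Q N (\<phi> (\<alpha> \<odot>\<^bsub>F i\<^esub> x))" if "x \<in> carrier (F i)" for N x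
      using that mod_hom_smult[OF Q \<alpha>] mod_hom_smult[OF hom \<alpha>] mod_hom_closed[OF hom] by (simp add: u_def)
    have uB: "u N \<in> lp_coboundaries G p F d i" for N
    proof (cases i)
      case 0
      \<comment> \<open>In degree 0 the only coboundary is zero, so the approximants have to vanish:
        \<open>\<alpha> x\<close> is itself a boundary, on which \<open>\<phi>\<close> is
        zero.\<close>
      have "u N = \<one>\<^bsub>?H 0\<^esub>"
      proof (rule extensionalityI[of _ "carrier (F 0)"])
        fix x assume x: "x \<in> carrier (F 0)"
        have "\<phi> (\<alpha> \<odot>\<^bsub>F i\<^esub> x) = (\<lambda>g. 0)"
          using \<phi>d[of "s 0 x"] 0 mod_hom_closed[OF s[of 0] x] s0[OF x] by simp
        then show "u N x = \<one>\<^bsub>?H 0\<^esub> x"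
          using u_eq[of x N] x 0 Q0 by (simp add: Hom_group_def)
      qed (auto simp: u_def Hom_group_def 0)
      then show ?thesis by (simp add: lp_coboundaries_def 0)
    next
      case (Suc k)
      \<comment> \<open>The cochain whose coboundary is \<open>u N\<close>: the homotopy lowers the
        degree of \<open>\<phi>\<close> by one.\<close>
      define \<psi> where "\<psi> = (\<lambda>x\<in>carrier (F k). Q N (\<phi> (s k x)))"
      have "(\<lambda>x. Q N (\<phi> (s k x))) \<in> mod_hom ?R (F k) ?L"
        using mod_hom_compose[OF mod_hom_compose[OF s[of k] hom[unfolded Suc]] Q] .
      then have \<psi>: "\<psi> \<in> carrier (?H k)"
        by (auto simp: \<psi>_def Hom_group_def mod_hom_def Pi_iff F.smult_closed)
      have "u N = compose (carrier (F (Suc k))) \<psi> (d (Suc k))"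
      proof (rule extensionalityI[of _ "carrier (F (Suc k))"])
        fix x assume x: "x \<in> carrier (F (Suc k))"
        have dx: "d (Suc k) x \<in> carrier (F k)" using mod_hom_closed[OF d x] .
        have sx: "s (Suc k) x \<in> carrier (F (Suc (Suc k)))" "s k (d (Suc k) x) \<in> carrier (F (Suc k))"
          using mod_hom_closed[OF s x] mod_hom_closed[OF s dx] by auto
        have "\<phi> (\<alpha> \<odot>\<^bsub>F i\<^esub> x) = \<phi> (s k (d (Suc k) x))"
          using mod_hom_add[OF hom[unfolded Suc] mod_hom_closed[OF d sx(1)] sx(2)] \<phi>d[unfolded Suc, OF sx(1)]
          by (simp add: Suc sSuc[OF x])
        then show "u N x = compose (carrier (F (Suc k))) \<psi> (d (Suc k)) x"
          using u_eq[of x N] x dx by (simp add: Suc compose_def \<psi>_def)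
      qed (auto simp: u_def Suc compose_def)
      then show ?thesis using \<psi> by (auto simp: lp_coboundaries_def Suc)
    qed
    have "limitin (Hom_lp_topology G p (F i)) u \<phi> sequentially"
      unfolding Hom_lp_topology_def limitin_subtopology limitin_componentwise
    proof (intro conjI ballI always_eventually allI ext)
      show "\<phi> \<in> carrier (?H i)" using \<phi> by (simp add: coc)
      show uc: "u N \<in> carrier (?H i)" for N using uB BZ subgroup.subset[OF sub] by blast
      then show "u N \<in> topspace (product_topology (\<lambda>x. lp_topology G p) (carrier (F i)))" for N
        using p1 by (auto simp: Hom_group_def mod_hom_def PiE_def)
      show "limitin (lp_topology G p) (\<lambda>N. u N x) (\<phi> x) sequentially" if "x \<in> carrier (F i)" for x
        using lim[of "\<phi> x"] mod_hom_closed[OF hom that] that by (simp add: u_def)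
    qed
    then show ?thesis using uB by (rule limitin_imp_closure_of)
  qed
  then have ZB: "lp_cocycles G p F d i \<subseteq> Hom_lp_topology G p (F i) closure_of lp_coboundaries G p F d i"
    by blast
  show ?thesis
    unfolding reduced_lp_cohomology_def
    by (rule trivial_group_Mod_closure[OF H topspace_Hom_lp_topology[OF p1] _ sub BZ ZB])
      (rule continuous_map_Hom_lp_translation[OF p1 H])
qed

section \<open>Homology\<close>

lemma sum_lessThan_add:
  fixes h :: "nat \<Rightarrow> 'c::comm_monoid_add"
  shows "(\<Sum>j<m + n. h j) = (\<Sum>j<m. h j) + (\<Sum>j<n. h (m + j))"
  by (induction n) (simp_all add: add.assoc)

locale lp_tensor = group G for G (structure) +
  fixes p :: real
  assumes p_ge_1: "p \<ge> 1"
begin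

abbreviation "L \<equiv> lp_module G p"

text \<open>Verbatim the generating set inside \<open>tensor_rel\<close>, so that the introduction
  and induction rules of \<open>generate\<close> apply to it.\<close>

abbreviation tensor_gens where
  "tensor_gens M \<equiv>
    {frag_of (x \<oplus>\<^bsub>M\<^esub> x', f) - frag_of (x, f) - frag_of (x', f) | x x' f.
        x \<in> carrier M \<and> x' \<in> carrier M \<and> f \<in> carrier L} \<union>
     {frag_of (x, f \<oplus>\<^bsub>L\<^esub> f') - frag_of (x, f) - frag_of (x, f') | x f f'.
        x \<in> carrier M \<and> f \<in> carrier L \<and> f' \<in> carrier L} \<union>
     {frag_of (group_ring_star G a \<odot>\<^bsub>M\<^esub> x, f) - frag_of (x, a \<odot>\<^bsub>L\<^esub> f) | a x f.
        a \<in> carrier (group_ring G) \<and> x \<in> carrier M \<and> f \<in> carrier L}"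

lemma group_ring_star_closed:
  "a \<in> carrier (group_ring G) \<Longrightarrow> group_ring_star G a \<in> carrier (group_ring G)"
  using keys_frag_extend[of "\<lambda>g. frag_of (inv g)" a] by (fastforce simp: group_ring_star_def)

lemma tensor_gens_closed:
  assumes M: "left_module (group_ring G) M" and "c \<in> tensor_gens M"
  shows "Poly_Mapping.keys c \<subseteq> carrier M \<times> lp_space G p"
proof -
  interpret M: left_module "group_ring G" M by fact
  have diff: "Poly_Mapping.keys (a - b) \<subseteq> S" if "Poly_Mapping.keys a \<subseteq> S" "Poly_Mapping.keys b \<subseteq> S"
    for a b :: "'c \<times> ('a \<Rightarrow> complex) \<Rightarrow>\<^sub>0 int" and S
    using that keys_diff[of a b] by blast
  from assms(2) consider
    (a) x x' f where "c = frag_of (x \<oplus>\<^bsub>M\<^esub> x', f) - frag_of (x, f) - frag_of (x', f)"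
      "x \<in> carrier M" "x' \<in> carrier M" "f \<in> lp_space G p"
  | (b) x f f' where "c = frag_of (x, \<lambda>g. f g + f' g) - frag_of (x, f) - frag_of (x, f')"
      "x \<in> carrier M" "f \<in> lp_space G p" "f' \<in> lp_space G p"
  | (c) a x f where "c = frag_of (group_ring_star G a \<odot>\<^bsub>M\<^esub> x, f) - frag_of (x, a \<odot>\<^bsub>L\<^esub> f)"
      "a \<in> carrier (group_ring G)" "x \<in> carrier M" "f \<in> lp_space G p"
    by auto
  then show ?thesis
  proof cases
    case a
    then show ?thesis unfolding a(1) by (intro diff) auto
  next
    case b
    then show ?thesis unfolding b(1) by (intro diff) (auto intro: lp_add_closed[OF p_ge_1])
  next
    case c
    then show ?thesis unfolding c(1)
      using M.smult_closed[OF group_ring_star_closed[OF c(2)] c(3)] lp_module_smult_closed[OF p_ge_1 _ c(4)]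
      by (intro diff) auto
  qed
qed

section \<open>Arithmetic modulo the tensor relations\<close>

lemma tensor_rel_subgroup:
  assumes M: "left_module (group_ring G) M"
  shows "subgroup (tensor_rel G M L) (tensor_free M L)"
proof -
  have "tensor_gens M \<subseteq> carrier (tensor_free M L)"
  proof
    fix c assume "c \<in> tensor_gens M"
    from tensor_gens_closed[OF M this] show "c \<in> carrier (tensor_free M L)" by simp
  qed
  then show ?thesis
    unfolding tensor_rel_def by (rule group.generate_is_subgroup[OF group_free_Abelian_group])
qed

context
  fixes M :: "('a \<Rightarrow>\<^sub>0 int, 'm, 'y) module_scheme"
  assumes M: "left_module (group_ring G) M"
begin

interpretation M: left_module "group_ring G" M by (rule M)
interpretation rel: subgroup "tensor_rel G M L" "tensor_free M L" by (rule tensor_rel_subgroup[OF M])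

lemma tensor_rel_keys: "r \<in> tensor_rel G M L \<Longrightarrow> Poly_Mapping.keys r \<subseteq> carrier M \<times> lp_space G p"
  using subsetD[OF rel.subset, of r] by simp

lemma tensor_rel_0: "0 \<in> tensor_rel G M L"
  using rel.one_closed by simp

lemma tensor_rel_plus: "r \<in> tensor_rel G M L \<Longrightarrow> r' \<in> tensor_rel G M L \<Longrightarrow> r + r' \<in> tensor_rel G M L"
  using rel.m_closed[of r r'] by simp

lemma tensor_rel_uminus: "r \<in> tensor_rel G M L \<Longrightarrow> - r \<in> tensor_rel G M L"
  using rel.m_inv_closed[of r] tensor_rel_keys[of r] by simp

lemma tensor_rel_minus: "r \<in> tensor_rel G M L \<Longrightarrow> r' \<in> tensor_rel G M L \<Longrightarrow> r - r' \<in> tensor_rel G M L"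
  using tensor_rel_plus[OF _ tensor_rel_uminus, of r r'] by simp

lemma tensor_rel_sum: "(\<And>j. j \<in> J \<Longrightarrow> r j \<in> tensor_rel G M L) \<Longrightarrow> (\<Sum>j\<in>J. r j) \<in> tensor_rel G M L"
  by (induction J rule: infinite_finite_induct) (auto intro: tensor_rel_0 tensor_rel_plus)

lemma tensor_rel_gens: "r \<in> tensor_gens M \<Longrightarrow> r \<in> tensor_rel G M L"
  unfolding tensor_rel_def by (rule generate.incl)

lemma tensor_rel_add_left:
  assumes "x \<in> carrier M" "x' \<in> carrier M" "f \<in> lp_space G p"
  shows "frag_of (x \<oplus>\<^bsub>M\<^esub> x', f) - frag_of (x, f) - frag_of (x', f) \<in> tensor_rel G M L"
  by (rule tensor_rel_gens) (use assms in auto)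

lemma tensor_rel_add_right:
  assumes "x \<in> carrier M" "f \<in> lp_space G p" "f' \<in> lp_space G p"
  shows "frag_of (x, \<lambda>g. f g + f' g) - frag_of (x, f) - frag_of (x, f') \<in> tensor_rel G M L"
proof (rule tensor_rel_gens)
  have "frag_of (x, \<lambda>g. f g + f' g) - frag_of (x, f) - frag_of (x, f') \<in>
    {frag_of (x, f \<oplus>\<^bsub>L\<^esub> f') - frag_of (x, f) - frag_of (x, f') | x f f'.
        x \<in> carrier M \<and> f \<in> carrier L \<and> f' \<in> carrier L}"
    using assms by (simp only: lp_module_simps) blast
  then show "frag_of (x, \<lambda>g. f g + f' g) - frag_of (x, f) - frag_of (x, f') \<in> tensor_gens M"
    by blast
qed

lemma tensor_rel_smult:
  assumes "a \<in> carrier (group_ring G)" "x \<in> carrier M" "f \<in> lp_space G p"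
  shows "frag_of (group_ring_star G a \<odot>\<^bsub>M\<^esub> x, f) - frag_of (x, a \<odot>\<^bsub>L\<^esub> f) \<in> tensor_rel G M L"
proof (rule tensor_rel_gens)
  have "frag_of (group_ring_star G a \<odot>\<^bsub>M\<^esub> x, f) - frag_of (x, a \<odot>\<^bsub>L\<^esub> f) \<in>
     {frag_of (group_ring_star G a \<odot>\<^bsub>M\<^esub> x, f) - frag_of (x, a \<odot>\<^bsub>L\<^esub> f) | a x f.
        a \<in> carrier (group_ring G) \<and> x \<in> carrier M \<and> f \<in> carrier L}"
    using assms by (simp only: lp_module_simps) blast
  then show "frag_of (group_ring_star G a \<odot>\<^bsub>M\<^esub> x, f) - frag_of (x, a \<odot>\<^bsub>L\<^esub> f) \<in> tensor_gens M"
    by blast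
qed

text \<open>Additivity at \<open>0 + 0\<close> yields the negative of this element.\<close>

lemma tensor_rel_zero_left:
  assumes "f \<in> lp_space G p"
  shows "frag_of (\<zero>\<^bsub>M\<^esub>, f) \<in> tensor_rel G M L"
  using tensor_rel_uminus[OF tensor_rel_add_left[OF M.M.zero_closed M.M.zero_closed assms]] by simp

text \<open>It absorbs signs into the second factor, so that tensors can be written as sums with all
  coefficients equal to 1.\<close>

lemma tensor_rel_neg_right:
  assumes "x \<in> carrier M" "f \<in> lp_space G p"
  shows "frag_of (x, f) + frag_of (x, \<lambda>g. - f g) \<in> tensor_rel G M L"
proof -
  have neg: "(\<lambda>g. - f g) \<in> lp_space G p" using lp_scale(1)[OF p_ge_1 assms(2), of "-1"] by simp
  have "frag_of (x, \<lambda>g. 0) \<in> tensor_rel G M L"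
    using tensor_rel_uminus[OF tensor_rel_add_right[OF assms(1) lp_zero(1)[OF p_ge_1] lp_zero(1)[OF p_ge_1]]] by simp
  from tensor_rel_minus[OF this tensor_rel_add_right[OF assms neg]] show ?thesis
    by (simp add: algebra_simps)
qed

text \<open>Every tensor is some \<open>tensor_sum\<close>, the only kind of element the topology
  refers to. The induction has a difference step, handled by concatenating two families and negating
  the second entries of the latter.\<close>

lemma tensor_sum_representative:
  assumes "Poly_Mapping.keys c \<subseteq> carrier M \<times> lp_space G p"
  shows "\<exists>(m::nat) x f. x \<in> {..<m} \<rightarrow> carrier M \<and> f \<in> {..<m} \<rightarrow>\<^sub>E lp_space G p \<and>
    c - (\<Sum>j<m. frag_of (x j, f j)) \<in> tensor_rel G M L"
  using assms
proof (induction c rule: frag_induction)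
  case zero
  show ?case
    by (intro exI[of _ 0] exI[of _ "\<lambda>_. undefined"]) (auto simp: tensor_rel_0 PiE_def extensional_def)
next
  case (one c)
  then show ?case
    by (intro exI[of _ 1] exI[of _ "\<lambda>j. fst c"] exI[of _ "\<lambda>j\<in>{..<1}. snd c"])
      (auto simp: tensor_rel_0)
next
  case (diff c c')
  from diff(1) obtain m :: nat and x f where 1: "x \<in> {..<m} \<rightarrow> carrier M" "f \<in> {..<m} \<rightarrow>\<^sub>E lp_space G p"
    "c - (\<Sum>j<m. frag_of (x j, f j)) \<in> tensor_rel G M L" by blast
  from diff(2) obtain m' :: nat and x' f' where 2: "x' \<in> {..<m'} \<rightarrow> carrier M" "f' \<in> {..<m'} \<rightarrow>\<^sub>E lp_space G p"
    "c' - (\<Sum>j<m'. frag_of (x' j, f' j)) \<in> tensor_rel G M L" by blast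
  let ?x = "\<lambda>j. if j < m then x j else x' (j - m)"
  let ?f = "\<lambda>j\<in>{..<m + m'}. if j < m then f j else (\<lambda>g. - f' (j - m) g)"
  have neg: "(\<lambda>g. - f' j g) \<in> lp_space G p" if "j < m'" for j
    using lp_scale(1)[OF p_ge_1, of "f' j" G "-1"] 2(2) that by (auto simp: PiE_iff)
  have "(\<Sum>j<m + m'. frag_of (?x j, ?f j)) =
      (\<Sum>j<m. frag_of (x j, f j)) + (\<Sum>j<m'. frag_of (x' j, \<lambda>g. - f' j g))"
    by (simp add: sum_lessThan_add)
  moreover have "(\<Sum>j<m'. frag_of (x' j, f' j) + frag_of (x' j, \<lambda>g. - f' j g)) \<in> tensor_rel G M L"
    using 2 by (intro tensor_rel_sum tensor_rel_neg_right) (auto simp: PiE_iff Pi_iff)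
  from tensor_rel_minus[OF tensor_rel_minus[OF 1(3) 2(3)] this]
  have "c - c' - ((\<Sum>j<m. frag_of (x j, f j)) + (\<Sum>j<m'. frag_of (x' j, \<lambda>g. - f' j g))) \<in> tensor_rel G M L"
    by (simp add: sum.distrib algebra_simps)
  ultimately have "c - c' - (\<Sum>j<m + m'. frag_of (?x j, ?f j)) \<in> tensor_rel G M L" by simp
  moreover have "?x \<in> {..<m + m'} \<rightarrow> carrier M" using 1 2 by (auto simp: Pi_iff)
  moreover have "?f \<in> {..<m + m'} \<rightarrow>\<^sub>E lp_space G p" using 1 2 neg by (auto simp: PiE_iff)
  ultimately show ?case by blast
qed

section \<open>The tensor product as a group of cosets, and its final topology\<close>

lemma tensor_comm_group: "comm_group (tensor G M L)"
  unfolding tensor_def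
  by (rule comm_group.abelian_FactGroup[OF abelian_free_Abelian_group tensor_rel_subgroup[OF M]])

lemma tensor_carrier_iff:
  "C \<in> carrier (tensor G M L) \<longleftrightarrow>
    (\<exists>c. Poly_Mapping.keys c \<subseteq> carrier M \<times> lp_space G p \<and> C = tensor_rel G M L #>\<^bsub>tensor_free M L\<^esub> c)"
  unfolding tensor_def FactGroup_def RCOSETS_def by (simp add: Bex_def)

lemma tensor_one: "\<one>\<^bsub>tensor G M L\<^esub> = tensor_rel G M L"
  by (simp add: tensor_def FactGroup_def)

lemma tensor_coset_mem:
  "c' \<in> tensor_rel G M L #>\<^bsub>tensor_free M L\<^esub> c \<longleftrightarrow> c' - c \<in> tensor_rel G M L"
proof -
  have "c' = r + c \<longleftrightarrow> r = c' - c" for r by auto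
  then show ?thesis by (simp add: r_coset_def)
qed

lemma tensor_coset_eq:
  "tensor_rel G M L #>\<^bsub>tensor_free M L\<^esub> c = tensor_rel G M L #>\<^bsub>tensor_free M L\<^esub> c' \<longleftrightarrow>
    c - c' \<in> tensor_rel G M L"
proof
  assume "tensor_rel G M L #>\<^bsub>tensor_free M L\<^esub> c = tensor_rel G M L #>\<^bsub>tensor_free M L\<^esub> c'"
  moreover have "c \<in> tensor_rel G M L #>\<^bsub>tensor_free M L\<^esub> c"
    by (simp only: tensor_coset_mem diff_self tensor_rel_0)
  ultimately show "c - c' \<in> tensor_rel G M L" by (simp only: tensor_coset_mem)
next
  assume *: "c - c' \<in> tensor_rel G M L"
  have "b - c \<in> tensor_rel G M L \<longleftrightarrow> b - c' \<in> tensor_rel G M L" for b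
    using tensor_rel_plus[OF _ *, of "b - c"] tensor_rel_minus[OF _ *, of "b - c'"] by auto
  then show "tensor_rel G M L #>\<^bsub>tensor_free M L\<^esub> c = tensor_rel G M L #>\<^bsub>tensor_free M L\<^esub> c'"
    by (auto simp only: tensor_coset_mem)
qed

lemma tensor_coset_mult:
  assumes "Poly_Mapping.keys c \<subseteq> carrier M \<times> lp_space G p" "Poly_Mapping.keys c' \<subseteq> carrier M \<times> lp_space G p"
  shows "(tensor_rel G M L #>\<^bsub>tensor_free M L\<^esub> c) \<otimes>\<^bsub>tensor G M L\<^esub> (tensor_rel G M L #>\<^bsub>tensor_free M L\<^esub> c') =
    tensor_rel G M L #>\<^bsub>tensor_free M L\<^esub> (c + c')"
  using normal.rcos_sum[OF comm_group.subgroup_imp_normal[OF abelian_free_Abelian_group tensor_rel_subgroup[OF M]],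
      of c c'] assms
  by (simp add: tensor_def FactGroup_def)

lemma tensor_sum_keys:
  assumes "x \<in> {..<m} \<rightarrow> carrier M" "f \<in> {..<m} \<rightarrow> lp_space G p"
  shows "Poly_Mapping.keys (\<Sum>j<m. frag_of (x j, f j)) \<subseteq> carrier M \<times> lp_space G p"
proof -
  have "(\<Sum>j<m. frag_of (x j, f j)) \<in> carrier (tensor_free M L)"
    by (rule sum_closed_free_Abelian_group) (use assms in \<open>auto simp: Pi_iff\<close>)
  then show ?thesis by simp
qed

lemma tensor_sum_closed:
  assumes "x \<in> {..<m} \<rightarrow> carrier M" "f \<in> {..<m} \<rightarrow>\<^sub>E lp_space G p"
  shows "tensor_sum G M L m x f \<in> carrier (tensor G M L)"
  unfolding tensor_sum_def tensor_carrier_iff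
  using tensor_sum_keys[OF assms(1), of f] assms(2)
  by (intro exI[of _ "\<Sum>j<m. frag_of (x j, f j)"] conjI refl) (auto simp: PiE_iff)

lemma tensor_carrier_sum:
  assumes "C \<in> carrier (tensor G M L)"
  obtains m x f where "x \<in> {..<m} \<rightarrow> carrier M" "f \<in> {..<m} \<rightarrow>\<^sub>E lp_space G p" "C = tensor_sum G M L m x f"
proof -
  from assms obtain c where c: "Poly_Mapping.keys c \<subseteq> carrier M \<times> lp_space G p"
    "C = tensor_rel G M L #>\<^bsub>tensor_free M L\<^esub> c" by (auto simp: tensor_carrier_iff)
  from tensor_sum_representative[OF c(1)] that show thesis
    unfolding c(2) tensor_sum_def tensor_coset_eq by blast
qed

lemma openin_tensor_lp_topology:
  "openin (tensor_lp_topology G p M) U \<longleftrightarrow>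
    U \<subseteq> carrier (tensor G M L) \<and>
    (\<forall>(m::nat) x. x \<in> {..<m} \<rightarrow> carrier M \<longrightarrow>
      openin (product_topology (\<lambda>j. lp_topology G p) {..<m})
        {f \<in> {..<m} \<rightarrow>\<^sub>E lp_space G p. tensor_sum G M L m x f \<in> U})"
proof -
  \<comment> \<open>\<open>topology\<close> can be evaluated only once this is known; it holds
    because preimages commute with intersections and unions.\<close>
  have "istopology (\<lambda>U. U \<subseteq> carrier (tensor G M L) \<and>
    (\<forall>(m::nat) x. x \<in> {..<m} \<rightarrow> carrier M \<longrightarrow>
      openin (product_topology (\<lambda>j. lp_topology G p) {..<m})
        {f \<in> {..<m} \<rightarrow>\<^sub>E lp_space G p. tensor_sum G M L m x f \<in> U}))" (is "istopology ?open")
    unfolding istopology_def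
  proof (intro conjI allI impI)
    fix S T assume ST: "?open S" "?open T"
    then show "S \<inter> T \<subseteq> carrier (tensor G M L)" by blast
    fix m :: nat and x :: "nat \<Rightarrow> 'm" assume x: "x \<in> {..<m} \<rightarrow> carrier M"
    have "{f \<in> {..<m} \<rightarrow>\<^sub>E lp_space G p. tensor_sum G M L m x f \<in> S \<inter> T} =
      {f \<in> {..<m} \<rightarrow>\<^sub>E lp_space G p. tensor_sum G M L m x f \<in> S} \<inter>
      {f \<in> {..<m} \<rightarrow>\<^sub>E lp_space G p. tensor_sum G M L m x f \<in> T}" by auto
    then show "openin (product_topology (\<lambda>j. lp_topology G p) {..<m})
        {f \<in> {..<m} \<rightarrow>\<^sub>E lp_space G p. tensor_sum G M L m x f \<in> S \<inter> T}"
      using ST x by (simp only:) (intro openin_Int, auto)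
  next
    fix K assume K: "\<forall>S\<in>K. ?open S"
    then show "\<Union>K \<subseteq> carrier (tensor G M L)" by blast
    fix m :: nat and x :: "nat \<Rightarrow> 'm" assume x: "x \<in> {..<m} \<rightarrow> carrier M"
    have "{f \<in> {..<m} \<rightarrow>\<^sub>E lp_space G p. tensor_sum G M L m x f \<in> \<Union>K} =
      (\<Union>S\<in>K. {f \<in> {..<m} \<rightarrow>\<^sub>E lp_space G p. tensor_sum G M L m x f \<in> S})" by auto
    then show "openin (product_topology (\<lambda>j. lp_topology G p) {..<m})
        {f \<in> {..<m} \<rightarrow>\<^sub>E lp_space G p. tensor_sum G M L m x f \<in> \<Union>K}"
      using K x by (simp only:) (intro openin_Union, auto)
  qed
  then show ?thesis unfolding tensor_lp_topology_def by simp
qed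

lemma topspace_tensor_lp_topology: "topspace (tensor_lp_topology G p M) = carrier (tensor G M L)"
proof
  show "topspace (tensor_lp_topology G p M) \<subseteq> carrier (tensor G M L)"
    using openin_topspace[of "tensor_lp_topology G p M"] unfolding openin_tensor_lp_topology by blast
  have "openin (tensor_lp_topology G p M) (carrier (tensor G M L))"
    unfolding openin_tensor_lp_topology
  proof (intro conjI allI impI order_refl)
    fix m :: nat and x assume x: "x \<in> {..<m} \<rightarrow> carrier M"
    have "{f \<in> {..<m} \<rightarrow>\<^sub>E lp_space G p. tensor_sum G M L m x f \<in> carrier (tensor G M L)} =
      topspace (product_topology (\<lambda>j. lp_topology G p) {..<m})"
      using tensor_sum_closed[OF x] p_ge_1 by auto
    then show "openin (product_topology (\<lambda>j. lp_topology G p) {..<m})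
       {f \<in> {..<m} \<rightarrow>\<^sub>E lp_space G p. tensor_sum G M L m x f \<in> carrier (tensor G M L)}"
      by (simp only: openin_topspace)
  qed
  then show "carrier (tensor G M L) \<subseteq> topspace (tensor_lp_topology G p M)"
    by (rule openin_subset)
qed

lemma continuous_map_tensor_sum:
  assumes "x \<in> {..<m} \<rightarrow> carrier M"
  shows "continuous_map (product_topology (\<lambda>j. lp_topology G p) {..<m}) (tensor_lp_topology G p M)
    (tensor_sum G M L m x)"
  unfolding continuous_map topspace_tensor_lp_topology
  using assms tensor_sum_closed[OF assms] p_ge_1 by (auto simp: openin_tensor_lp_topology)

text \<open>The universal property of a final topology: continuity is tested on the maps that define
  it.\<close>

lemma continuous_map_from_tensor:
  assumes f: "f \<in> carrier (tensor G M L) \<rightarrow> topspace T"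
    and cont: "\<And>m x. x \<in> {..<m} \<rightarrow> carrier M \<Longrightarrow>
      continuous_map (product_topology (\<lambda>j. lp_topology G p) {..<m}) T (\<lambda>h. f (tensor_sum G M L m x h))"
  shows "continuous_map (tensor_lp_topology G p M) T f"
  unfolding continuous_map topspace_tensor_lp_topology
proof (intro conjI allI impI)
  show "f ` carrier (tensor G M L) \<subseteq> topspace T" using f by auto
  fix U assume U: "openin T U"
  show "openin (tensor_lp_topology G p M) {x \<in> carrier (tensor G M L). f x \<in> U}"
    unfolding openin_tensor_lp_topology
  proof (intro conjI allI impI)
    fix m :: nat and x assume x: "x \<in> {..<m} \<rightarrow> carrier M"
    have "{h \<in> {..<m} \<rightarrow>\<^sub>E lp_space G p. tensor_sum G M L m x h \<in> {x \<in> carrier (tensor G M L). f x \<in> U}} =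
      {h \<in> topspace (product_topology (\<lambda>j. lp_topology G p) {..<m}). f (tensor_sum G M L m x h) \<in> U}"
      using tensor_sum_closed[OF x] p_ge_1 by auto
    then show "openin (product_topology (\<lambda>j. lp_topology G p) {..<m})
      {h \<in> {..<m} \<rightarrow>\<^sub>E lp_space G p. tensor_sum G M L m x h \<in> {x \<in> carrier (tensor G M L). f x \<in> U}}"
      using openin_continuous_map_preimage[OF cont[OF x] U] by simp
  qed auto
qed

text \<open>Writing \<open>C\<close> as a tensor sum of length \<open>m'\<close>, adding it to a sum
  of length \<open>m\<close> gives a sum of length \<open>m + m'\<close> whose extra entries are
  constant. The translate is thus another defining map of the final topology, preceded by a
  continuous inclusion of tuples.\<close>

lemma continuous_map_tensor_translation:
  assumes C: "C \<in> carrier (tensor G M L)"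
  shows "continuous_map (tensor_lp_topology G p M) (tensor_lp_topology G p M) (\<lambda>D. D \<otimes>\<^bsub>tensor G M L\<^esub> C)"
proof (rule continuous_map_from_tensor)
  interpret T: comm_group "tensor G M L" by (rule tensor_comm_group)
  show "(\<lambda>D. D \<otimes>\<^bsub>tensor G M L\<^esub> C) \<in> carrier (tensor G M L) \<rightarrow> topspace (tensor_lp_topology G p M)"
    using C by (simp add: topspace_tensor_lp_topology)
  fix m :: nat and x assume x: "x \<in> {..<m} \<rightarrow> carrier M"
  obtain m' x' f' where x': "x' \<in> {..<m'} \<rightarrow> carrier M" and f': "f' \<in> {..<m'} \<rightarrow>\<^sub>E lp_space G p"
    and C_eq: "C = tensor_sum G M L m' x' f'" using tensor_carrier_sum[OF C] .
  let ?x = "\<lambda>j. if j < m then x j else x' (j - m)"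
  let ?f = "\<lambda>f. \<lambda>j\<in>{..<m + m'}. if j < m then f j else f' (j - m)"
  let ?P = "\<lambda>m. product_topology (\<lambda>j. lp_topology G p) {..<m}"
  have "continuous_map (?P m) (?P (m + m')) ?f"
    unfolding continuous_map_componentwise
  proof (intro conjI ballI)
    fix j assume j: "j \<in> {..<m + m'}"
    show "continuous_map (?P m) (lp_topology G p) (\<lambda>f. ?f f j)"
    proof (cases "j < m")
      case True
      then show ?thesis
        using continuous_map_product_projection[of j "{..<m}" "\<lambda>j. lp_topology G p"] by simp
    next
      case False
      then have "f' (j - m) \<in> lp_space G p" using f' j by (auto simp: PiE_iff)
      then show ?thesis using False j p_ge_1 by simp
    qed
  qed auto
  moreover have "?x \<in> {..<m + m'} \<rightarrow> carrier M" using x x' by (auto simp: Pi_iff)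
  ultimately have "continuous_map (?P m) (tensor_lp_topology G p M) (tensor_sum G M L (m + m') ?x \<circ> ?f)"
    by (intro continuous_map_compose[OF _ continuous_map_tensor_sum])
  then show "continuous_map (?P m) (tensor_lp_topology G p M) (\<lambda>f. tensor_sum G M L m x f \<otimes>\<^bsub>tensor G M L\<^esub> C)"
  proof (rule continuous_map_eq)
    fix f assume "f \<in> topspace (?P m)"
    then have f: "f \<in> {..<m} \<rightarrow> lp_space G p" using p_ge_1 by (auto simp: PiE_iff)
    have f'': "f' \<in> {..<m'} \<rightarrow> lp_space G p" using f' by (auto simp: PiE_iff)
    show "(tensor_sum G M L (m + m') ?x \<circ> ?f) f = tensor_sum G M L m x f \<otimes>\<^bsub>tensor G M L\<^esub> C"
      unfolding C_eq tensor_sum_def tensor_coset_mult[OF tensor_sum_keys[OF x f] tensor_sum_keys[OF x' f'']] o_def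
      by (simp add: sum_lessThan_add)
  qed
qed

end

section \<open>Functoriality of the tensor product in both factors\<close>

lemma id_mod_hom: "id \<in> mod_hom R N N"
  by (simp add: mod_hom_def)

text \<open>Both factors vary at once because two instances are needed: a boundary map with the
  identity, and the homotopy together with \<open>Q N\<close>.\<close>

lemma tensor_rel_map:
  assumes M: "left_module (group_ring G) M" and M': "left_module (group_ring G) M'"
    and \<beta>: "\<beta> \<in> mod_hom (group_ring G) M M'" and \<gamma>: "\<gamma> \<in> mod_hom (group_ring G) L L"
    and c: "c \<in> tensor_rel G M L"
  shows "frag_extend (\<lambda>(x, f). frag_of (\<beta> x, \<gamma> f)) c \<in> tensor_rel G M' L"
proof -
  interpret M: left_module "group_ring G" M by fact
  let ?E = "frag_extend (\<lambda>(x, f). frag_of (\<beta> x, \<gamma> f))"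
  note \<beta>c = mod_hom_closed[OF \<beta>]
  have \<gamma>c: "\<gamma> f \<in> lp_space G p" if "f \<in> lp_space G p" for f
    using mod_hom_closed[OF \<gamma>] that by simp
  have gens: "?E c \<in> tensor_rel G M' L" if "c \<in> tensor_gens M" for c
  proof -
    from that consider
      (a) x x' f where "c = frag_of (x \<oplus>\<^bsub>M\<^esub> x', f) - frag_of (x, f) - frag_of (x', f)"
        "x \<in> carrier M" "x' \<in> carrier M" "f \<in> lp_space G p"
    | (b) x f f' where "c = frag_of (x, \<lambda>g. f g + f' g) - frag_of (x, f) - frag_of (x, f')"
        "x \<in> carrier M" "f \<in> lp_space G p" "f' \<in> lp_space G p"
    | (c) a x f where "c = frag_of (group_ring_star G a \<odot>\<^bsub>M\<^esub> x, f) - frag_of (x, a \<odot>\<^bsub>L\<^esub> f)"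
        "a \<in> carrier (group_ring G)" "x \<in> carrier M" "f \<in> lp_space G p"
      by auto
    then show ?thesis
    proof cases
      case a
      then show ?thesis
        using tensor_rel_add_left[OF M' \<beta>c[OF a(2)] \<beta>c[OF a(3)] \<gamma>c[OF a(4)]] mod_hom_add[OF \<beta> a(2,3)]
        by (simp add: frag_extend_diff)
    next
      case b
      have "\<gamma> (\<lambda>g. f g + f' g) = (\<lambda>g. \<gamma> f g + \<gamma> f' g)"
        using mod_hom_add[OF \<gamma>, of f f'] b by simp
      then show ?thesis
        using tensor_rel_add_right[OF M' \<beta>c[OF b(2)] \<gamma>c[OF b(3)] \<gamma>c[OF b(4)]]
        by (simp add: frag_extend_diff b(1))
    next
      case c
      have "\<gamma> (a \<odot>\<^bsub>L\<^esub> f) = a \<odot>\<^bsub>L\<^esub> \<gamma> f"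
        using mod_hom_smult[OF \<gamma> c(2)] c(4) by simp
      then show ?thesis
        using tensor_rel_smult[OF M' c(2) \<beta>c[OF c(3)] \<gamma>c[OF c(4)]]
          mod_hom_smult[OF \<beta> group_ring_star_closed[OF c(2)] c(3)]
        by (simp only: c(1) frag_extend_diff frag_extend_of prod.case)
    qed
  qed
  show ?thesis
    using c unfolding tensor_rel_def[of G M]
  proof (induction rule: generate.induct)
    case one
    then show ?case using tensor_rel_0[OF M'] by simp
  next
    case (incl h)
    then show ?case by (rule gens)
  next
    case (inv h)
    have "inv\<^bsub>tensor_free M L\<^esub> h = - h"
      using tensor_gens_closed[OF M inv] by simp
    then show ?case
      using tensor_rel_uminus[OF M' gens[OF inv]] by (simp only: frag_extend_minus)
  next
    case (eng h1 h2)
    then show ?case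
      using tensor_rel_plus[OF M'] by (simp add: frag_extend_add)
  qed
qed

lemma tensor_map_coset:
  assumes M: "left_module (group_ring G) M" and M': "left_module (group_ring G) M'"
    and \<beta>: "\<beta> \<in> mod_hom (group_ring G) M M'"
  shows "tensor_map G M' L \<beta> (tensor_rel G M L #>\<^bsub>tensor_free M L\<^esub> c) =
    tensor_rel G M' L #>\<^bsub>tensor_free M' L\<^esub> frag_extend (\<lambda>(x, f). frag_of (\<beta> x, f)) c"
proof -
  let ?E = "frag_extend (\<lambda>(x, f). frag_of (\<beta> x, f))"
  have "tensor_rel G M' L #>\<^bsub>tensor_free M' L\<^esub> ?E c' = tensor_rel G M' L #>\<^bsub>tensor_free M' L\<^esub> ?E c"
    if "c' \<in> tensor_rel G M L #>\<^bsub>tensor_free M L\<^esub> c" for c'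
  proof -
    have "c' - c \<in> tensor_rel G M L" using that by (simp only: tensor_coset_mem[OF M])
    from tensor_rel_map[OF M M' \<beta> id_mod_hom this] show ?thesis
      unfolding tensor_coset_eq[OF M'] by (simp only: frag_extend_diff id_apply)
  qed
  moreover have "c \<in> tensor_rel G M L #>\<^bsub>tensor_free M L\<^esub> c"
    by (simp only: tensor_coset_mem[OF M] diff_self tensor_rel_0[OF M])
  ultimately show ?thesis unfolding tensor_map_def by blast
qed

lemma keys_tensor_extend:
  assumes \<beta>: "\<beta> \<in> mod_hom (group_ring G) M M'"
    and c: "Poly_Mapping.keys c \<subseteq> carrier M \<times> lp_space G p"
  shows "Poly_Mapping.keys (frag_extend (\<lambda>(x, f). frag_of (\<beta> x, f)) c) \<subseteq> carrier M' \<times> lp_space G p"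
proof (rule order_trans[OF keys_frag_extend])
  show "(\<Union>x\<in>Poly_Mapping.keys c. Poly_Mapping.keys (case x of (x, f) \<Rightarrow> frag_of (\<beta> x, f))) \<subseteq>
      carrier M' \<times> lp_space G p"
    using c mod_hom_closed[OF \<beta>] by auto
qed

lemma tensor_map_hom:
  assumes M: "left_module (group_ring G) M" and M': "left_module (group_ring G) M'"
    and \<beta>: "\<beta> \<in> mod_hom (group_ring G) M M'"
  shows "tensor_map G M' L \<beta> \<in> hom (tensor G M L) (tensor G M' L)"
proof (rule homI)
  fix C assume "C \<in> carrier (tensor G M L)"
  then obtain c where c: "Poly_Mapping.keys c \<subseteq> carrier M \<times> lp_space G p"
    "C = tensor_rel G M L #>\<^bsub>tensor_free M L\<^esub> c" by (auto simp only: tensor_carrier_iff[OF M])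
  show "tensor_map G M' L \<beta> C \<in> carrier (tensor G M' L)"
    unfolding c(2) tensor_map_coset[OF assms] tensor_carrier_iff[OF M']
    using keys_tensor_extend[OF \<beta> c(1)] by blast
  fix C' assume "C' \<in> carrier (tensor G M L)"
  then obtain c' where c': "Poly_Mapping.keys c' \<subseteq> carrier M \<times> lp_space G p"
    "C' = tensor_rel G M L #>\<^bsub>tensor_free M L\<^esub> c'" by (auto simp only: tensor_carrier_iff[OF M])
  show "tensor_map G M' L \<beta> (C \<otimes>\<^bsub>tensor G M L\<^esub> C') =
      tensor_map G M' L \<beta> C \<otimes>\<^bsub>tensor G M' L\<^esub> tensor_map G M' L \<beta> C'"
    unfolding c(2) c'(2) tensor_coset_mult[OF M c(1) c'(1)] tensor_map_coset[OF assms]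
      tensor_coset_mult[OF M' keys_tensor_extend[OF \<beta> c(1)] keys_tensor_extend[OF \<beta> c'(1)]]
      frag_extend_add ..
qed

lemma tensor_boundary_boundary:
  assumes M: "left_module (group_ring G) M"
    and \<beta>: "\<And>x. x \<in> carrier N \<Longrightarrow> \<beta> (\<gamma> x) = \<zero>\<^bsub>M\<^esub>"
    and c: "Poly_Mapping.keys c \<subseteq> carrier N \<times> lp_space G p"
  shows "frag_extend (\<lambda>(x, f). frag_of (\<beta> x, f)) (frag_extend (\<lambda>(x, f). frag_of (\<gamma> x, f)) c) \<in> tensor_rel G M L"
  using c
proof (induction c rule: frag_induction)
  case (one c)
  then show ?case using tensor_rel_zero_left[OF M, of "snd c"] \<beta>[of "fst c"] by (cases c) simp
next
  case (diff a b)
  then show ?case using tensor_rel_minus[OF M] by (simp add: frag_extend_diff)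
qed (simp add: tensor_rel_0[OF M])

end

text \<open>A cycle is written as a sum of \<open>x\<^sub>j \<otimes> f\<^sub>j\<close> and
  approximated by \<open>x\<^sub>j \<otimes> \<alpha>' Q\<^sub>N f\<^sub>j\<close>, which equals
  \<open>\<alpha> x\<^sub>j \<otimes> Q\<^sub>N f\<^sub>j\<close>. The homotopy splits
  \<open>\<alpha>\<close> into \<open>d s + s d\<close>: the first part is a boundary, and the
  second is the image of the boundary of the cycle under \<open>s \<otimes> Q\<^sub>N\<close>, hence
  zero.\<close>

lemma reduced_lp_homology_trivial:
  fixes G :: "('g, 'x) monoid_scheme" and F :: "nat \<Rightarrow> ('g \<Rightarrow>\<^sub>0 int, 'm) module"
  assumes p: "p > 1" and G: "group G" and z: "z \<in> group_center G" "infinite_order G z"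
    and res: "projective_resolution G F d \<epsilon>"
  shows "trivial_group (reduced_lp_homology G p F d i)"
proof -
  interpret G: group G by fact
  have p1: "p \<ge> 1" using p by simp
  interpret lp_tensor G p by unfold_locales (rule p1)
  let ?R = "group_ring G"
  let ?T = "\<lambda>j. tensor G (F j) L" and ?rel = "\<lambda>j. tensor_rel G (F j) L"
  let ?cos = "\<lambda>j c. tensor_rel G (F j) L #>\<^bsub>tensor_free (F j) L\<^esub> c"
  let ?keys = "\<lambda>j. carrier (F j) \<times> lp_space G p"
  let ?D = "\<lambda>j. frag_extend (\<lambda>(x, f). frag_of (d (Suc j) x, f)) :: ('m \<times> ('g \<Rightarrow> complex) \<Rightarrow>\<^sub>0 int) \<Rightarrow> _"
  note lm = projective_resolutionD(1)[OF res] and d = projective_resolutionD(2)[OF res]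
    and dd = projective_resolutionD(3)[OF res]
  interpret F: left_module ?R "F j" for j by (rule lm)
  have zc: "z \<in> carrier G" using z by (simp add: group_center_def)
  define \<alpha> where "\<alpha> = frag_of z - frag_of \<one>\<^bsub>G\<^esub>"
  \<comment> \<open>The inverse compensates for the involution that turns left modules into right
    ones: \<open>\<alpha>'\<close> on the second factor corresponds to \<open>\<alpha>\<close> on
    the first.\<close>
  define \<alpha>' where "\<alpha>' = frag_of (inv\<^bsub>G\<^esub> z) - frag_of \<one>\<^bsub>G\<^esub>"
  have \<alpha>': "\<alpha>' \<in> carrier ?R"
    using G.keys_group_ring_diff[of "inv\<^bsub>G\<^esub> z"] zc by (simp add: \<alpha>'_def)
  have star: "group_ring_star G \<alpha>' = \<alpha>"
    unfolding \<alpha>'_def \<alpha>_def G.group_ring_star_diff using zc by simp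
  obtain s where s: "\<And>j. s j \<in> mod_hom ?R (F j) (F (Suc j))"
    and s0: "\<And>x. x \<in> carrier (F 0) \<Longrightarrow> \<alpha> \<odot>\<^bsub>F 0\<^esub> x = d 1 (s 0 x)"
    and sSuc: "\<And>j x. x \<in> carrier (F (Suc j)) \<Longrightarrow>
      \<alpha> \<odot>\<^bsub>F (Suc j)\<^esub> x = d (Suc (Suc j)) (s (Suc j) x) \<oplus>\<^bsub>F (Suc j)\<^esub> s j (d (Suc j) x)"
    using central_null_homotopy[OF G z(1) res] unfolding \<alpha>_def by metis
  obtain Q where Q: "\<And>N. Q N \<in> mod_hom ?R L L"
    and lim: "\<And>f. f \<in> lp_space G p \<Longrightarrow> limitin (lp_topology G p) (\<lambda>N. \<alpha>' \<odot>\<^bsub>L\<^esub> Q N f) f sequentially"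
    using G.lp_mean_ergodic[OF p G.group_center_inv[OF z(1)] G.infinite_order_inv[OF zc z(2)]]
    unfolding \<alpha>'_def by metis
  have Qc: "Q N f \<in> lp_space G p" if "f \<in> lp_space G p" for N f
    using mod_hom_closed[OF Q] that by simp
  have T: "comm_group (?T j)" for j by (rule tensor_comm_group[OF lm])
  have coset: "tensor_map G (F j) L (d (Suc j)) (?cos (Suc j) c) = ?cos j (?D j c)" for j c
    by (rule tensor_map_coset[OF lm lm d])
  \<comment> \<open>The cycle condition is restated for representatives in the free abelian group,
    where it can be fed to \<open>tensor_rel_map\<close>.\<close>
  have cycle: "?cos (Suc k) c \<in> lp_cycles G p F d (Suc k) \<longleftrightarrow> ?D k c \<in> ?rel k"
    if "Poly_Mapping.keys c \<subseteq> ?keys (Suc k)" for k c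
  proof -
    have "?cos (Suc k) c \<in> carrier (?T (Suc k))"
      unfolding tensor_carrier_iff[OF lm] using that by blast
    moreover have "?cos k (?D k c) = ?rel k \<longleftrightarrow> ?D k c \<in> ?rel k"
    proof -
      have "?cos k 0 = ?rel k" by (simp add: r_coset_def)
      then show ?thesis using tensor_coset_eq[OF lm, of k "?D k c" 0] by (simp only: diff_zero)
    qed
    ultimately show ?thesis
      by (simp only: lp_cycles_def nat.case kernel_def mem_Collect_eq coset tensor_one[OF lm] simp_thms)
  qed
  have sub: "subgroup (lp_cycles G p F d i) (?T i)"
  proof (cases i)
    case 0
    interpret T0: comm_group "?T 0" by (rule T)
    show ?thesis using T0.subgroup_self 0 by (simp add: lp_cycles_def)
  next
    case (Suc k)
    interpret T1: comm_group "?T (Suc k)" by (rule T)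
    interpret T0: comm_group "?T k" by (rule T)
    show ?thesis
      unfolding Suc lp_cycles_def nat.case
      by (rule group_hom.subgroup_kernel[OF group_hom.intro[OF T1.is_group T0.is_group
            group_hom_axioms.intro[OF tensor_map_hom[OF lm lm d]]]])
  qed
  have BZ: "lp_boundaries G p F d i \<subseteq> lp_cycles G p F d i"
  proof
    fix C assume "C \<in> lp_boundaries G p F d i"
    then obtain c where c: "Poly_Mapping.keys c \<subseteq> ?keys (Suc i)" and C: "C = ?cos i (?D i c)"
      by (auto simp only: lp_boundaries_def tensor_carrier_iff[OF lm] coset)
    have keys: "Poly_Mapping.keys (?D i c) \<subseteq> ?keys i" by (rule keys_tensor_extend[OF d c])
    show "C \<in> lp_cycles G p F d i"
    proof (cases i)
      case 0
      then show ?thesis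
        unfolding C using keys by (simp only: lp_cycles_def nat.case tensor_carrier_iff[OF lm]) blast
    next
      case (Suc k)
      have "?D k (?D (Suc k) c) \<in> ?rel k"
        using c unfolding Suc by (intro tensor_boundary_boundary[OF lm]) (rule dd)
      then show ?thesis
        using keys cycle[of "?D (Suc k) c" k] unfolding C Suc by blast
    qed
  qed
  have "C \<in> tensor_lp_topology G p (F i) closure_of lp_boundaries G p F d i"
    if C: "C \<in> lp_cycles G p F d i" for C
  proof -
    have CT: "C \<in> carrier (?T i)" using subgroup.subset[OF sub] C by blast
    obtain m x f where x: "x \<in> {..<m} \<rightarrow> carrier (F i)" and f: "f \<in> {..<m} \<rightarrow>\<^sub>E lp_space G p"
      and C_eq: "C = tensor_sum G (F i) L m x f"
      using tensor_carrier_sum[OF lm CT] .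
    have xj: "x j \<in> carrier (F i)" and fj: "f j \<in> lp_space G p" if "j < m" for j
      using x f that by (auto simp: Pi_iff PiE_iff)
    define u where "u = (\<lambda>N. \<lambda>j\<in>{..<m}. \<alpha>' \<odot>\<^bsub>L\<^esub> Q N (f j))"
    have uB: "tensor_sum G (F i) L m x (u N) \<in> lp_boundaries G p F d i" for N
    proof -
      \<comment> \<open>The chain, one degree higher, whose boundary is the approximant modulo
        relations.\<close>
      let ?b = "\<Sum>j<m. frag_of (s i (x j), Q N (f j))"
      have b: "Poly_Mapping.keys ?b \<subseteq> ?keys (Suc i)"
        using xj fj Qc mod_hom_closed[OF s] by (intro tensor_sum_keys[OF lm]) auto
      have Db: "?D i ?b = (\<Sum>j<m. frag_of (d (Suc i) (s i (x j)), Q N (f j)))"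
        by (simp add: frag_extend_sum o_def)
      have smult: "(\<Sum>j<m. frag_of (\<alpha> \<odot>\<^bsub>F i\<^esub> x j, Q N (f j)) - frag_of (x j, \<alpha>' \<odot>\<^bsub>L\<^esub> Q N (f j))) \<in> ?rel i"
        using tensor_rel_smult[OF lm \<alpha>' xj Qc[OF fj]]
        by (intro tensor_rel_sum[OF lm]) (simp only: star lessThan_iff)
      have "(\<Sum>j<m. frag_of (\<alpha> \<odot>\<^bsub>F i\<^esub> x j, Q N (f j)) - frag_of (d (Suc i) (s i (x j)), Q N (f j))) \<in> ?rel i"
      proof (cases i)
        case 0
        have "(\<Sum>j<m. frag_of (\<alpha> \<odot>\<^bsub>F i\<^esub> x j, Q N (f j)) - frag_of (d (Suc i) (s i (x j)), Q N (f j))) = 0"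
          using s0 xj 0 by (intro sum.neutral) auto
        then show ?thesis using tensor_rel_0[OF lm] by simp
      next
        case (Suc k)
        let ?c = "\<Sum>j<m. frag_of (x j, f j)"
        have "Poly_Mapping.keys ?c \<subseteq> ?keys (Suc k)"
          using x f unfolding Suc by (intro tensor_sum_keys[OF lm]) (auto simp: PiE_iff)
        then have "?D k ?c \<in> ?rel k"
          using C cycle unfolding C_eq tensor_sum_def Suc by blast
        \<comment> \<open>The cycle condition concerns the whole sum and not its single terms, so
          \<open>s k \<otimes> Q N\<close> is applied to the relation as a whole.\<close>
        from tensor_rel_map[OF lm lm s Q this, of N]
        have "(\<Sum>j<m. frag_of (s k (d (Suc k) (x j)), Q N (f j))) \<in> ?rel (Suc k)"
          by (simp add: frag_extend_sum o_def)
        moreover have "(\<Sum>j<m. frag_of (\<alpha> \<odot>\<^bsub>F i\<^esub> x j, Q N (f j)) - frag_of (d (Suc i) (s i (x j)), Q N (f j))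
            - frag_of (s k (d (Suc k) (x j)), Q N (f j))) \<in> ?rel (Suc k)"
        proof (rule tensor_rel_sum[OF lm])
          fix j assume "j \<in> {..<m}"
          then have j: "x j \<in> carrier (F (Suc k))" "Q N (f j) \<in> lp_space G p"
            using xj fj Qc Suc by auto
          show "frag_of (\<alpha> \<odot>\<^bsub>F i\<^esub> x j, Q N (f j)) - frag_of (d (Suc i) (s i (x j)), Q N (f j))
            - frag_of (s k (d (Suc k) (x j)), Q N (f j)) \<in> ?rel (Suc k)"
            unfolding Suc sSuc[OF j(1)]
            by (intro tensor_rel_add_left[OF lm] mod_hom_closed[OF d] mod_hom_closed[OF s] j)
        qed
        ultimately have "(\<Sum>j<m. frag_of (s k (d (Suc k) (x j)), Q N (f j))) +
          (\<Sum>j<m. frag_of (\<alpha> \<odot>\<^bsub>F i\<^esub> x j, Q N (f j)) - frag_of (d (Suc i) (s i (x j)), Q N (f j))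
            - frag_of (s k (d (Suc k) (x j)), Q N (f j))) \<in> ?rel (Suc k)"
          by (rule tensor_rel_plus[OF lm])
        then show ?thesis unfolding Suc by (simp add: sum_subtractf)
      qed
      from tensor_rel_minus[OF lm this smult]
      have "(\<Sum>j<m. frag_of (x j, u N j)) - ?D i ?b \<in> ?rel i"
        unfolding Db by (simp add: sum_subtractf u_def)
      then have "tensor_sum G (F i) L m x (u N) = ?cos i (?D i ?b)"
        unfolding tensor_sum_def tensor_coset_eq[OF lm] .
      also have "\<dots> = tensor_map G (F i) L (d (Suc i)) (?cos (Suc i) ?b)" by (rule coset[symmetric])
      also have "\<dots> \<in> lp_boundaries G p F d i"
        unfolding lp_boundaries_def
        by (rule imageI) (use b in \<open>simp only: tensor_carrier_iff[OF lm], blast\<close>)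
      finally show ?thesis .
    qed
    \<comment> \<open>Convergence is checked for tuples with the \<open>x j\<close> held fixed, and
      then carried over by the continuous map \<open>tensor_sum\<close>; no neighbourhoods in the
      final topology have to be described.\<close>
    have "limitin (product_topology (\<lambda>j. lp_topology G p) {..<m}) u f sequentially"
      unfolding limitin_componentwise
    proof (intro conjI ballI always_eventually allI)
      show "f \<in> extensional {..<m}" using f by (simp add: PiE_iff)
      show "u N \<in> topspace (product_topology (\<lambda>j. lp_topology G p) {..<m})" for N
        using G.lp_module_smult_closed[OF p1 _ Qc[OF fj]] \<alpha>' p1 by (auto simp: u_def)
      show "limitin (lp_topology G p) (\<lambda>N. u N j) (f j) sequentially" if "j \<in> {..<m}" for j
        using lim[OF fj] that by (simp add: u_def)
    qed
    from continuous_map_limit[OF continuous_map_tensor_sum[OF lm x] this]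
    show ?thesis
      unfolding C_eq using uB by (intro limitin_imp_closure_of) (auto simp: o_def)
  qed
  then have ZB: "lp_cycles G p F d i \<subseteq> tensor_lp_topology G p (F i) closure_of lp_boundaries G p F d i"
    by blast
  show ?thesis
    unfolding reduced_lp_homology_def
    by (rule trivial_group_Mod_closure[OF T topspace_tensor_lp_topology[OF lm] _ sub BZ ZB])
      (rule continuous_map_tensor_translation[OF lm])
qed

theorem corollary5p5:
  fixes G :: "('g, 'x) monoid_scheme"
    and p :: real and n :: nat
    and F :: "nat \<Rightarrow> ('g \<Rightarrow>\<^sub>0 int, 'm) module"
    and d :: "nat \<Rightarrow> 'm \<Rightarrow> 'm"
    and \<epsilon> :: "'m \<Rightarrow> int"
  assumes "p > 1"
    and "group G"
    and "type_FP G n"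
    and "\<exists>z\<in>group_center G. infinite_order G z"
    and "projective_resolution G F d \<epsilon>"
    and "\<forall>i\<le>n. fin_gen_module (group_ring G) (F i)"
  shows "\<forall>i\<le>n. trivial_group (reduced_lp_homology G p F d i) \<and>
               trivial_group (reduced_lp_cohomology G p F d i)"
  using reduced_lp_homology_trivial[OF assms(1,2) _ _ assms(5)]
    reduced_lp_cohomology_trivial[OF assms(1,2) _ _ assms(5)] assms(4) by blast

end
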